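(* The general Heun equation $$u''(x)+\left(-\frac1{2x}+\frac{1+\alpha}{x-1}+\frac1{x-t}\right)u'(x)-\frac{n(n+2\alpha+1)x+n\sqrt t}{4x(x-1)(x-t)}\,u(x)=0$$ can be transformed (by the method of isomonodromic deformations with respect to $t$) into a Painlevé VI equation.
   Context: Here $n$ is a positive integer (the degree of an orthogonal polynomial), $\alpha>0$, and $t=a_0^2$ with $a_0\in(0,1)$, so $t\in(0,1)$. The equation arises from the polynomials orthogonal with respect to the weight $(1-x^2)^{\alpha}\big(1-\chi_{(-a_0,a_0)}(x)\big)$ on $[-1,1]$, where $\chi_{(-a_0,a_0)}$ is the indicator function of $(-a_0,a_0)$. "Transformed" refers to the following method of isomonodromic deformations. Write the equation as $\sigma u''+\tau u'+\eta u=0$ with $\sigma,\tau,\eta$ polynomials in $x$ that may depend on $t$. Introduce additional parameters $\lambda,\mu$ with $\sigma(\lambda)\ne0$, and the deformed equation $$\sigma(x)\varphi''+\left(\tau(x)-\frac{\sigma(x)}{x-\lambda}\right)\varphi'+\left(\eta(x)-\eta(\lambda)-\mu\big(\tau(\lambda)-\sigma'(\lambda)\big)-\mu^2\sigma(\lambda)+\frac{\mu\,\sigma(\lambda)}{x-\lambda}\right)\varphi=0,$$ which has an additional non-logarithmic singularity at $x=\lambda$. Let $\lambda,\mu$ depend on $t$ and require the deformed equation to be compatible with an equation $\partial_t\varphi=a(x,t)\,\partial_x\varphi+b(x,t)\,\varphi$ for suitable compatibility functions $a,b$. This compatibility is expressed by a Hamiltonian system $\dot\lambda=\partial H/\partial\mu$,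 $\dot\mu=-\partial H/\partial\lambda$. Eliminating $\mu$ gives a second order equation for $\lambda$, which is to be a Painlevé equation, possibly after a change of variables. The Painlevé VI equation with parameters $(A,B,C,D)$ is $$\frac{d^2y}{dt^2}=\frac12\left(\frac1y+\frac1{y-1}+\frac1{y-t}\right)\left(\frac{dy}{dt}\right)^2-\left(\frac1t+\frac1{t-1}+\frac1{y-t}\right)\frac{dy}{dt}+\frac{y(y-1)(y-t)}{t^2(t-1)^2}\left(A+\frac{Bt}{y^2}+\frac{C(t-1)}{(y-1)^2}+\frac{Dt(t-1)}{(y-t)^2}\right).$$ *)

theory Defs
  imports "HOL-Complex_Analysis.Complex_Analysis" "HOL-Computational_Algebra.Polynomial"
begin

text \<open>
  Throughout, the deformation parameter \<open>t\<close> is real, while the independent variable \<open>x\<close> and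
  the dependent quantities are complex. A \<open>coeff\<close> is a coefficient function of \<open>t\<close> and \<open>x\<close>,
  in this order.
\<close>

type_synonym coeff = "real \<Rightarrow> complex \<Rightarrow> complex"

text \<open>
  \<open>u'' + p u' + q u = 0\<close> is written as \<open>\<sigma> u'' + \<tau> u' + \<eta> u = 0\<close>. Requiring that there be no
  common root makes the three polynomials unique up to a common factor that depends on \<open>t\<close> only;
  such a factor does not change the deformed equation below.
\<close>

definition polynomial_form ::
  "real set \<Rightarrow> coeff \<Rightarrow> coeff \<Rightarrow>
   (real \<Rightarrow> complex poly) \<Rightarrow> (real \<Rightarrow> complex poly) \<Rightarrow> (real \<Rightarrow> complex poly) \<Rightarrow> bool" where
  "polynomial_form T p q \<sigma> \<tau> \<eta> \<longleftrightarrow>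
     (\<forall>t\<in>T. \<sigma> t \<noteq> 0
        \<and> (\<nexists>x. poly (\<sigma> t) x = 0 \<and> poly (\<tau> t) x = 0 \<and> poly (\<eta> t) x = 0)
        \<and> (\<forall>x. poly (\<sigma> t) x \<noteq> 0 \<longrightarrow>
              p t x = poly (\<tau> t) x / poly (\<sigma> t) x \<and> q t x = poly (\<eta> t) x / poly (\<sigma> t) x))"


text \<open>
  The deformed equation \<open>\<sigma> \<phi>'' + deformed_coeff1 \<phi>' + deformed_coeff0 \<phi> = 0\<close>, for fixed \<open>t\<close>,
  with the additional singularity \<open>x = l\<close>.
\<close>

definition deformed_coeff1 ::
  "complex poly \<Rightarrow> complex poly \<Rightarrow> complex \<Rightarrow> complex \<Rightarrow> complex" where
  "deformed_coeff1 s1 t1 l x = poly t1 x - poly s1 x / (x - l)"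

definition deformed_coeff0 ::
  "complex poly \<Rightarrow> complex poly \<Rightarrow> complex poly \<Rightarrow> complex \<Rightarrow> complex \<Rightarrow> complex \<Rightarrow> complex" where
  "deformed_coeff0 s1 t1 e1 l m x =
     poly e1 x - poly e1 l - m * (poly t1 l - poly (pderiv s1) l) - m\<^sup>2 * poly s1 l
       + m * poly s1 l / (x - l)"


text \<open>
  Cross-differentiation of the pair
    \<open>\<phi>\<^sub>x\<^sub>x = P \<phi>\<^sub>x + Q \<phi>\<close>,  \<open>\<phi>\<^sub>t = a \<phi>\<^sub>x + b \<phi>\<close>.
  A pair \<open>(f, g)\<close> stands for the linear form \<open>f \<phi> + g \<phi>\<^sub>x\<close>, so that \<open>\<phi>\<^sub>x\<^sub>x\<close> is \<open>(Q, P)\<close> and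
  \<open>\<phi>\<^sub>t\<close> is \<open>(b, a)\<close>. The two operators differentiate such a form with respect to \<open>x\<close> and \<open>t\<close> and
  rewrite the result as a form of the same kind by means of the two equations; \<open>\<phi>\<^sub>x\<^sub>t\<close> is
  obtained as the \<open>x\<close>-derivative of \<open>\<phi>\<^sub>t\<close>.
\<close>

definition form_dx :: "coeff \<Rightarrow> coeff \<Rightarrow> coeff \<times> coeff \<Rightarrow> coeff \<times> coeff" where
  "form_dx P Q = (\<lambda>(f, g).
     (\<lambda>t x. deriv (f t) x + g t x * Q t x,
      \<lambda>t x. f t x + deriv (g t) x + g t x * P t x))"

definition form_dt ::
  "coeff \<Rightarrow> coeff \<Rightarrow> coeff \<Rightarrow> coeff \<Rightarrow> coeff \<times> coeff \<Rightarrow> coeff \<times> coeff" where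
  "form_dt P Q a b = (\<lambda>(f, g).
     let (v, u) = form_dx P Q (b, a) in
     (\<lambda>t x. vector_derivative (\<lambda>s. f s x) (at t) + f t x * b t x + g t x * v t x,
      \<lambda>t x. f t x * a t x + vector_derivative (\<lambda>s. g s x) (at t) + g t x * u t x))"

text \<open>
  Compatibility on the set of all \<open>(t, x)\<close> with \<open>t \<in> I\<close>, \<open>x \<in> X t\<close>: the two ways of computing
  the mixed derivative, \<open>(\<phi>\<^sub>x\<^sub>x)\<^sub>t\<close> and \<open>(\<phi>\<^sub>t)\<^sub>x\<^sub>x\<close>, give the same linear form in \<open>\<phi>, \<phi>\<^sub>x\<close>.
  The regularity conditions ensure that all derivatives that occur exist.
\<close>

definition compatible ::
  "real set \<Rightarrow> (real \<Rightarrow> complex set) \<Rightarrow> coeff \<Rightarrow> coeff \<Rightarrow> coeff \<Rightarrow> coeff \<Rightarrow> bool" where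
  "compatible I X P Q a b \<longleftrightarrow>
     (\<forall>t\<in>I. P t holomorphic_on X t \<and> Q t holomorphic_on X t
          \<and> a t holomorphic_on X t \<and> b t holomorphic_on X t)
   \<and> (\<forall>t\<in>I. \<forall>x\<in>X t. (\<lambda>s. P s x) differentiable (at t) \<and> (\<lambda>s. Q s x) differentiable (at t))
   \<and> (\<forall>t\<in>I. \<forall>x\<in>X t.
        fst (form_dt P Q a b (Q, P)) t x = fst (form_dx P Q (form_dx P Q (b, a))) t x
      \<and> snd (form_dt P Q a b (Q, P)) t x = snd (form_dx P Q (form_dx P Q (b, a))) t x)"

definition deformed_compatible ::
  "(real \<Rightarrow> complex poly) \<Rightarrow> (real \<Rightarrow> complex poly) \<Rightarrow> (real \<Rightarrow> complex poly) \<Rightarrow>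
   real set \<Rightarrow> (real \<Rightarrow> complex) \<Rightarrow> (real \<Rightarrow> complex) \<Rightarrow> coeff \<Rightarrow> coeff \<Rightarrow> bool" where
  "deformed_compatible \<sigma> \<tau> \<eta> I lam mu a b \<longleftrightarrow>
     compatible I (\<lambda>t. {x. poly (\<sigma> t) x \<noteq> 0 \<and> x \<noteq> lam t})
       (\<lambda>t x. - deformed_coeff1 (\<sigma> t) (\<tau> t) (lam t) x / poly (\<sigma> t) x)
       (\<lambda>t x. - deformed_coeff0 (\<sigma> t) (\<tau> t) (\<eta> t) (lam t) (mu t) x / poly (\<sigma> t) x)
       a b"


text \<open>The argument order is \<open>H t \<lambda> \<mu>\<close>.\<close>

definition hamiltonian_system ::
  "(real \<Rightarrow> complex \<Rightarrow> complex \<Rightarrow> complex) \<Rightarrow>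
   real set \<Rightarrow> (real \<Rightarrow> complex) \<Rightarrow> (real \<Rightarrow> complex) \<Rightarrow> bool" where
  "hamiltonian_system H I lam mu \<longleftrightarrow>
     (\<forall>t\<in>I. \<exists>Hl Hm.
        ((\<lambda>l. H t l (mu t)) has_field_derivative Hl) (at (lam t))
      \<and> ((\<lambda>m. H t (lam t) m) has_field_derivative Hm) (at (mu t))
      \<and> (lam has_vector_derivative Hm) (at t)
      \<and> (mu has_vector_derivative - Hl) (at t))"

definition solves_P6 ::
  "complex \<Rightarrow> complex \<Rightarrow> complex \<Rightarrow> complex \<Rightarrow> real set \<Rightarrow> (real \<Rightarrow> complex) \<Rightarrow> bool" where
  "solves_P6 A B C D I y \<longleftrightarrow>
     (\<exists>y' y''. \<forall>t\<in>I.
        (y has_vector_derivative y' t) (at t)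
      \<and> (y' has_vector_derivative y'' t) (at t)
      \<and> y t \<notin> {0, 1, of_real t}
      \<and> (let w = y t; w' = y' t; z = complex_of_real t in
          y'' t = 1/2 * (1/w + 1/(w - 1) + 1/(w - z)) * w'\<^sup>2
                - (1/z + 1/(z - 1) + 1/(w - z)) * w'
                + w * (w - 1) * (w - z) / (z\<^sup>2 * (z - 1)\<^sup>2)
                  * (A + B * z / w\<^sup>2 + C * (z - 1) / (w - 1)\<^sup>2
                       + D * z * (z - 1) / (w - z)\<^sup>2)))"


text \<open>
  The equation \<open>u'' + p u' + q u = 0\<close>, with \<open>t \<in> T\<close>, is transformed into a Painleve VI equation
  by the method of isomonodromic deformations: there are compatibility functions
  \<open>a t \<lambda> \<mu> x\<close>, \<open>b t \<lambda> \<mu> x\<close> and a Hamiltonian \<open>H t \<lambda> \<mu>\<close> such that along all differentiable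
  \<open>\<lambda>(t), \<mu>(t)\<close> compatibility is expressed by the Hamiltonian system, and such that eliminating
  \<open>\<mu>\<close> from this system results in a Painleve VI equation for \<open>\<lambda>\<close> itself, with constant
  parameters. (No further change of variables is allowed for here.)
\<close>

definition isomonodromic_to_P6 :: "real set \<Rightarrow> coeff \<Rightarrow> coeff \<Rightarrow> bool" where
  "isomonodromic_to_P6 T p q \<longleftrightarrow>
     (\<exists>\<sigma> \<tau> \<eta>. polynomial_form T p q \<sigma> \<tau> \<eta> \<and>
       (\<exists>a b H.
          (\<forall>I lam mu.
             open I \<and> I \<subseteq> T
             \<and> (\<forall>t\<in>I. lam differentiable (at t) \<and> mu differentiable (at t)
                     \<and> poly (\<sigma> t) (lam t) \<noteq> 0)
             \<longrightarrow> (deformed_compatible \<sigma> \<tau> \<eta> I lam mu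
                     (\<lambda>t. a t (lam t) (mu t)) (\<lambda>t. b t (lam t) (mu t))
                  \<longleftrightarrow> hamiltonian_system H I lam mu))
        \<and> (\<exists>A B C D.
             \<forall>I lam. open I \<and> I \<subseteq> T \<and> (\<forall>t\<in>I. poly (\<sigma> t) (lam t) \<noteq> 0)
             \<longrightarrow> ((\<exists>mu. hamiltonian_system H I lam mu) \<longleftrightarrow> solves_P6 A B C D I lam))))"

end

theory Submission
  imports Defs
begin

text \<open>
The equation belongs to a family that can be treated as a whole: every Heun equation
\<open>u'' + (\<gamma>/x + \<delta>/(x - 1) + \<epsilon>/(x - t)) u' + (k x + h(t)) / (x (x - 1) (x - t)) u = 0\<close>
with \<open>\<gamma>, \<delta>, \<epsilon> \<noteq> 0\<close> deforms isomonodromically to a Painleve VI equation. In the deformed equation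
only \<open>\<eta>(x) - \<eta>(\<lambda>) = k (x - \<lambda>)\<close> occurs, so the accessory parameter \<open>h\<close>, and with it the
term \<open>n \<surd>t\<close>, cancels; what remains is the Fuchsian equation of Fuchs and Garnier with the
apparent singularity \<open>\<lambda>\<close> and the momentum \<open>\<mu>\<close>.

Put \<open>\<sigma>(x) = x (x - 1) (x - t)\<close> and write the deformed equation as \<open>\<phi>\<^sub>x\<^sub>x = P \<phi>\<^sub>x + Q \<phi>\<close>.
Comparing coefficients of \<open>\<phi>\<^sub>x\<close> and \<open>\<phi>\<close>, compatibility with \<open>\<phi>\<^sub>t = a \<phi>\<^sub>x + b \<phi>\<close> means
\<open>P\<^sub>t = 2 b' + a'' + (a P)'\<close> and \<open>Q\<^sub>t + P b' = b'' + 2 a' Q + a Q'\<close> (\<open>compatible_at_iff\<close>). Take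
\<open>a = (\<lambda> - t) x (x - 1) / (t (t - 1) (x - \<lambda>))\<close>, which vanishes at the fixed singularities \<open>0, 1\<close>
and equals \<open>-1\<close> at the moving one, and \<open>b = - \<sigma>(\<lambda>) \<mu> / (t (t - 1) (x - \<lambda>))\<close>. All poles other
than a double one at \<open>\<lambda>\<close> then cancel in the first relation, and it says \<open>(\<lambda>' - H\<^sub>\<mu>) / (x - \<lambda>)\<^sup>2 = 0\<close>. In the
second one the derivative of \<open>Q\<close> along the flow of \<open>H\<close> accounts for everything, leaving
\<open>N\<^sub>\<lambda> (\<lambda>' - H\<^sub>\<mu>) + N\<^sub>\<mu> (\<mu>' + H\<^sub>\<lambda>) = 0\<close>, where \<open>N = - \<sigma> Q\<close> is a function of \<open>t, \<lambda>, \<mu>, x\<close>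
(\<open>first_order_residual\<close>, \<open>zeroth_order_residual\<close>). As \<open>N\<^sub>\<mu>\<close> is not identically zero in \<open>x\<close>,
the two relations together are Hamilton's equations.

For the elimination, \<open>H\<close> is quadratic in \<open>\<mu>\<close> with leading coefficient \<open>\<sigma>(\<lambda>) / (t (t - 1)) \<noteq> 0\<close>, so
\<open>\<lambda>' = H\<^sub>\<mu>\<close> can be solved for \<open>\<mu>\<close>. The other equation then prescribes \<open>\<lambda>''\<close>, and a
partial fraction expansion identifies it as Painleve VI (\<open>painleve_identity\<close>). Since \<open>\<mu>\<close> is
determined by \<open>\<lambda>\<close> and \<open>\<lambda>'\<close>, the argument can be read backwards, which gives the equivalence.
\<close>

section \<open>Derivatives with respect to the deformation parameter\<close>

lemma has_vector_derivative_quotient: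
  fixes f g :: "real \<Rightarrow> 'a::real_normed_field"
  assumes "(f has_vector_derivative f') (at t)" "(g has_vector_derivative g') (at t)" "g t \<noteq> 0"
  shows "((\<lambda>s. f s / g s) has_vector_derivative (f' * g t - f t * g') / (g t)\<^sup>2) (at t)"
proof -
  have "((\<lambda>s. f s / g s) has_derivative
      (\<lambda>h. - f t * (inverse (g t) * (h *\<^sub>R g') * inverse (g t)) + (h *\<^sub>R f') / g t)) (at t)"
    using assms unfolding has_vector_derivative_def by (intro has_derivative_divide)
  also have "(\<lambda>h. - f t * (inverse (g t) * (h *\<^sub>R g') * inverse (g t)) + (h *\<^sub>R f') / g t)
     = (\<lambda>h. h *\<^sub>R ((f' * g t - f t * g') / (g t)\<^sup>2))"
    using assms(3) by (auto simp: scaleR_conv_of_real field_simps power2_eq_square)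
  finally show ?thesis unfolding has_vector_derivative_def .
qed

lemma has_vector_derivative_power2:
  fixes f :: "real \<Rightarrow> 'a::real_normed_field"
  assumes "(f has_vector_derivative f') (at t)"
  shows "((\<lambda>s. (f s)\<^sup>2) has_vector_derivative 2 * f t * f') (at t)"
  using has_vector_derivative_mult[OF assms assms] by (simp add: power2_eq_square algebra_simps)

lemmas vector_derivative_rules =
  has_vector_derivative_quotient has_vector_derivative_power2 has_vector_derivative_mult
  has_vector_derivative_add has_vector_derivative_diff has_vector_derivative_minus
  has_vector_derivative_const has_vector_derivative_of_real DERIV_ident

section \<open>Compatibility as two scalar equations\<close>

text \<open>
The mixed derivatives of \<open>\<phi>\<close> agree iff the coefficients of \<open>\<phi>\<^sub>x\<close> and of \<open>\<phi>\<close> agree. In the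
difference the function \<open>b\<close> itself drops out and only \<open>b'\<close> and \<open>b''\<close> are left: multiplying
\<open>\<phi>\<close> by a function of \<open>t\<close> alone does not disturb compatibility.
\<close>

lemma compatible_at_iff:
  assumes "open X" "x \<in> X"
    and P: "P t holomorphic_on X" and Q: "Q t holomorphic_on X"
    and a: "a t holomorphic_on X" and b: "b t holomorphic_on X"
  shows "fst (form_dt P Q a b (Q, P)) t x = fst (form_dx P Q (form_dx P Q (b, a))) t x
       \<and> snd (form_dt P Q a b (Q, P)) t x = snd (form_dx P Q (form_dx P Q (b, a))) t x
     \<longleftrightarrow>
       vector_derivative (\<lambda>s. P s x) (at t)
         = 2 * deriv (b t) x + deriv (deriv (a t)) x + deriv (a t) x * P t x + a t x * deriv (P t) x
     \<and> vector_derivative (\<lambda>s. Q s x) (at t) + P t x * deriv (b t) x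
         = deriv (deriv (b t)) x + 2 * deriv (a t) x * Q t x + a t x * deriv (Q t) x"
proof -
  have diff: "f field_differentiable at x" if "f holomorphic_on X" for f
    using that assms(1,2) by (meson holomorphic_on_imp_differentiable_at)
  note D = diff[OF P] diff[OF Q] diff[OF a] diff[OF b]
    diff[OF holomorphic_deriv[OF a \<open>open X\<close>]] diff[OF holomorphic_deriv[OF b \<open>open X\<close>]]
  have *: "deriv (\<lambda>x. deriv (b t) x + a t x * Q t x) x
       = deriv (deriv (b t)) x + (a t x * deriv (Q t) x + deriv (a t) x * Q t x)"
    using D by (simp add: field_differentiable_mult)
  have **: "deriv (\<lambda>x. b t x + deriv (a t) x + a t x * P t x) x
       = deriv (b t) x + deriv (deriv (a t)) x + (a t x * deriv (P t) x + deriv (a t) x * P t x)"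
    using D by (simp add: field_differentiable_mult field_differentiable_add)
  show ?thesis
    unfolding form_dt_def form_dx_def Let_def prod.case fst_conv snd_conv * **
    by (auto simp: algebra_simps)
qed

lemma deriv_deriv_eq:
  assumes "open X" "x \<in> X" "\<And>y. y \<in> X \<Longrightarrow> (f has_field_derivative f' y) (at y)"
    "(f' has_field_derivative D) (at x)"
  shows "deriv (deriv f) x = D"
  using assms
  by (intro DERIV_imp_deriv has_field_derivative_transform_within_open[OF assms(4) assms(1,2)])
     (metis DERIV_imp_deriv)

lemma hamiltonian_system_iff:
  assumes "\<And>t. t \<in> I \<Longrightarrow> ((\<lambda>l. H t l (mu t)) has_field_derivative Hl t) (at (lam t))"
    "\<And>t. t \<in> I \<Longrightarrow> ((\<lambda>m. H t (lam t) m) has_field_derivative Hm t) (at (mu t))"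
  shows "hamiltonian_system H I lam mu \<longleftrightarrow>
    (\<forall>t\<in>I. (lam has_vector_derivative Hm t) (at t) \<and> (mu has_vector_derivative - Hl t) (at t))"
  unfolding hamiltonian_system_def
proof (rule ball_cong[OF refl])
  fix t assume t: "t \<in> I"
  show "(\<exists>Hl Hm. ((\<lambda>l. H t l (mu t)) has_field_derivative Hl) (at (lam t))
      \<and> ((\<lambda>m. H t (lam t) m) has_field_derivative Hm) (at (mu t))
      \<and> (lam has_vector_derivative Hm) (at t) \<and> (mu has_vector_derivative - Hl) (at t))
    \<longleftrightarrow> (lam has_vector_derivative Hm t) (at t) \<and> (mu has_vector_derivative - Hl t) (at t)"
    using DERIV_unique[OF assms(1)[OF t]] DERIV_unique[OF assms(2)[OF t]] assms[OF t] by blast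
qed

section \<open>The deformed Heun equation\<close>

text \<open>
With \<open>z\<close> in place of \<open>t\<close>, this is the leading coefficient \<open>\<sigma>\<close>, and then its derivative in the
second argument. A complex \<open>z\<close> keeps the algebra free of coercions.
\<close>

definition cubic :: "complex \<Rightarrow> complex \<Rightarrow> complex" where
  "cubic z l = l * (l - 1) * (l - z)"

definition cubic' :: "complex \<Rightarrow> complex \<Rightarrow> complex" where
  "cubic' z l = (l - 1) * (l - z) + l * (l - z) + l * (l - 1)"

lemma cubic_eq_0_iff: "cubic z x = 0 \<longleftrightarrow> x = 0 \<or> x = 1 \<or> x = z"
  by (auto simp: cubic_def)

lemma has_field_derivative_cubic:
  "(cubic z has_field_derivative cubic' z x) (at x)"
  unfolding cubic_def cubic'_def by (auto intro!: derivative_eq_intros simp: algebra_simps)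

lemma has_vector_derivative_cubic:
  assumes "(lam has_vector_derivative l') (at t)"
  shows "((\<lambda>s. cubic (of_real s) (lam s)) has_vector_derivative
     cubic' (of_real t) (lam t) * l' - lam t * (lam t - 1)) (at t)"
  unfolding cubic_def cubic'_def
  by (rule has_vector_derivative_eq_rhs, (rule vector_derivative_rules assms)+)
     (simp add: algebra_simps)

locale heun =
  fixes \<gamma> \<delta> \<epsilon> k :: complex
begin

text \<open>
The combination \<open>\<tau> - \<sigma>'\<close>, in which \<open>\<mu>\<close> enters the deformed equation linearly, with its
derivatives with respect to \<open>l\<close> and to \<open>z\<close>.
\<close>

definition drift :: "complex \<Rightarrow> complex \<Rightarrow> complex" where
  "drift z l = (\<gamma> - 1) * (l - 1) * (l - z) + (\<delta> - 1) * l * (l - z) + (\<epsilon> - 1) * l * (l - 1)"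

definition drift' :: "complex \<Rightarrow> complex \<Rightarrow> complex" where
  "drift' z l = (\<gamma> - 1) * (2 * l - 1 - z) + (\<delta> - 1) * (2 * l - z) + (\<epsilon> - 1) * (2 * l - 1)"

definition drift_t :: "complex \<Rightarrow> complex" where
  "drift_t l = - (\<gamma> - 1) * (l - 1) - (\<delta> - 1) * l"

text \<open>
The last coefficient \<open>- \<sigma> Q\<close> of the deformed equation, with its partial derivatives in \<open>l\<close>, \<open>m\<close>
and \<open>z\<close>.
\<close>

definition numer :: "complex \<Rightarrow> complex \<Rightarrow> complex \<Rightarrow> complex \<Rightarrow> complex" where
  "numer z l m x = k * (x - l) - m * drift z l - m\<^sup>2 * cubic z l + m * cubic z l / (x - l)"

definition numer_l :: "complex \<Rightarrow> complex \<Rightarrow> complex \<Rightarrow> complex \<Rightarrow> complex" where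
  "numer_l z l m x = - k - m * drift' z l - m\<^sup>2 * cubic' z l
     + m * cubic' z l / (x - l) + m * cubic z l / (x - l)\<^sup>2"

definition numer_m :: "complex \<Rightarrow> complex \<Rightarrow> complex \<Rightarrow> complex \<Rightarrow> complex" where
  "numer_m z l m x = - drift z l - 2 * m * cubic z l + cubic z l / (x - l)"

definition numer_t :: "complex \<Rightarrow> complex \<Rightarrow> complex \<Rightarrow> complex" where
  "numer_t l m x = - m * drift_t l + m\<^sup>2 * (l * (l - 1)) - m * (l * (l - 1)) / (x - l)"

text \<open>
The Hamiltonian is the residue of \<open>Q\<close> at the moving singularity, that is, \<open>- numer t l m t / (t (t - 1))\<close>.
\<close>

definition hamiltonian :: "real \<Rightarrow> complex \<Rightarrow> complex \<Rightarrow> complex" where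
  "hamiltonian t l m =
     (cubic t l * m\<^sup>2 + (drift t l + l * (l - 1)) * m + k * (l - t)) / (t * (t - 1))"

definition ham_l :: "complex \<Rightarrow> complex \<Rightarrow> complex \<Rightarrow> complex" where
  "ham_l z l m = (cubic' z l * m\<^sup>2 + (drift' z l + (2 * l - 1)) * m + k) / (z * (z - 1))"

definition ham_m :: "complex \<Rightarrow> complex \<Rightarrow> complex \<Rightarrow> complex" where
  "ham_m z l m = (2 * cubic z l * m + drift z l + l * (l - 1)) / (z * (z - 1))"

text \<open>
\<open>coeff1\<close> and \<open>coeff0\<close> are \<open>P\<close> and \<open>Q\<close>. In the total \<open>t\<close>-derivatives \<open>coeff1_t\<close> and \<open>coeff0_t\<close>
the arguments \<open>l'\<close> and \<open>m'\<close> stand for the velocities of \<open>\<lambda>\<close> and \<open>\<mu>\<close>.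
\<close>

definition coeff1 :: "complex \<Rightarrow> complex \<Rightarrow> complex \<Rightarrow> complex" where
  "coeff1 z l x = - (drift z x + cubic' z x - cubic z x / (x - l)) / cubic z x"

definition coeff1_x :: "complex \<Rightarrow> complex \<Rightarrow> complex \<Rightarrow> complex" where
  "coeff1_x z l x = \<gamma> / x\<^sup>2 + \<delta> / (x - 1)\<^sup>2 + \<epsilon> / (x - z)\<^sup>2 - 1 / (x - l)\<^sup>2"

definition coeff1_t :: "complex \<Rightarrow> complex \<Rightarrow> complex \<Rightarrow> complex \<Rightarrow> complex" where
  "coeff1_t z l l' x = - \<epsilon> / (x - z)\<^sup>2 + l' / (x - l)\<^sup>2"

definition coeff0 :: "complex \<Rightarrow> complex \<Rightarrow> complex \<Rightarrow> complex \<Rightarrow> complex" where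
  "coeff0 z l m x = - numer z l m x / cubic z x"

definition coeff0_x :: "complex \<Rightarrow> complex \<Rightarrow> complex \<Rightarrow> complex \<Rightarrow> complex" where
  "coeff0_x z l m x =
     (- (k - m * cubic z l / (x - l)\<^sup>2) + numer z l m x * cubic' z x / cubic z x) / cubic z x"

definition coeff0_t :: "complex \<Rightarrow> complex \<Rightarrow> complex \<Rightarrow> complex \<Rightarrow> complex \<Rightarrow> complex \<Rightarrow> complex" where
  "coeff0_t z l m l' m' x =
    (- (numer_t l m x + numer_l z l m x * l' + numer_m z l m x * m')
       - numer z l m x / (x - z)) / cubic z x"

text \<open>
The function \<open>a\<close> has zeros at the fixed singular points \<open>0\<close> and \<open>1\<close>, takes the value \<open>-1\<close> at
\<open>x = z\<close>, so that this point moves with unit speed, and has a simple pole at the apparent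
singularity. The residue of \<open>b\<close> is the one for which the velocity of \<open>\<lambda>\<close> in
\<open>first_order_residual\<close> becomes a derivative of the Hamiltonian.
\<close>

definition compat_a :: "complex \<Rightarrow> complex \<Rightarrow> complex \<Rightarrow> complex" where
  "compat_a z l x = (l - z) * x * (x - 1) / (z * (z - 1) * (x - l))"
definition compat_a' :: "complex \<Rightarrow> complex \<Rightarrow> complex \<Rightarrow> complex" where
  "compat_a' z l x = (l - z) * (1 - l * (l - 1) / (x - l)\<^sup>2) / (z * (z - 1))"
definition compat_a'' :: "complex \<Rightarrow> complex \<Rightarrow> complex \<Rightarrow> complex" where
  "compat_a'' z l x = 2 * cubic z l / (z * (z - 1) * (x - l) ^ 3)"
definition compat_b :: "complex \<Rightarrow> complex \<Rightarrow> complex \<Rightarrow> complex \<Rightarrow> complex" where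
  "compat_b z l m x = - cubic z l * m / (z * (z - 1) * (x - l))"
definition compat_b' :: "complex \<Rightarrow> complex \<Rightarrow> complex \<Rightarrow> complex \<Rightarrow> complex" where
  "compat_b' z l m x = cubic z l * m / (z * (z - 1) * (x - l)\<^sup>2)"
definition compat_b'' :: "complex \<Rightarrow> complex \<Rightarrow> complex \<Rightarrow> complex \<Rightarrow> complex" where
  "compat_b'' z l m x = - 2 * cubic z l * m / (z * (z - 1) * (x - l) ^ 3)"

lemma coeff1_partial_fractions:
  assumes "cubic z x \<noteq> 0"
  shows "coeff1 z l x = - (\<gamma> / x + \<delta> / (x - 1) + \<epsilon> / (x - z)) + 1 / (x - l)"
proof -
  have "x \<noteq> 0" "x - 1 \<noteq> 0" "x - z \<noteq> 0" using assms by (auto simp: cubic_def)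
  hence *: "(drift z x + cubic' z x) / cubic z x = \<gamma> / x + \<delta> / (x - 1) + \<epsilon> / (x - z)"
    unfolding cubic_def cubic'_def drift_def by (simp add: divide_simps) (simp add: algebra_simps)
  show ?thesis using assms unfolding *[symmetric] coeff1_def by (simp add: diff_divide_distrib)
qed

text \<open>
Both sides are rational in \<open>x\<close>. Expanding \<open>(a P)'\<close> over the terms of \<open>P\<close>, the summands with
poles at \<open>0\<close> and \<open>1\<close> lose these poles because \<open>a\<close> vanishes there, and the double pole at \<open>z\<close> is
the one of \<open>P\<^sub>t\<close> because \<open>a = -1\<close> there. The triple pole at \<open>l\<close> is cancelled by \<open>a''\<close>, so only a
double pole at \<open>l\<close> survives.
\<close>

lemma first_order_residual:
  assumes "cubic z x \<noteq> 0" "x \<noteq> l" "z \<noteq> 0" "z \<noteq> 1"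
  shows "coeff1_t z l l' x - (2 * compat_b' z l m x + compat_a'' z l x + compat_a' z l x * coeff1 z l x
       + compat_a z l x * coeff1_x z l x) = (l' - ham_m z l m) / (x - l)\<^sup>2"
proof -
  define w d where "w = z * (z - 1)" and "d = x - l"
  have nz: "x \<noteq> 0" "x - 1 \<noteq> 0" "x - z \<noteq> 0" "d \<noteq> 0" "w \<noteq> 0"
    using assms by (auto simp: cubic_def w_def d_def)
  have x: "x = l + d" by (simp add: d_def)
  \<comment> \<open>the contributions of the four poles of \<open>P\<close> to \<open>(a P)'\<close>\<close>
  have e0: "(1 - l * (l - 1) / d\<^sup>2) / x - x * (x - 1) / d / x\<^sup>2 = - (l - 1) / d\<^sup>2"
    using nz by (simp add: divide_simps d_def) (simp add: algebra_simps power2_eq_square)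
  have e1: "(1 - l * (l - 1) / d\<^sup>2) / (x - 1) - x * (x - 1) / d / (x - 1)\<^sup>2 = - l / d\<^sup>2"
    using nz by (simp add: divide_simps d_def) (simp add: algebra_simps power2_eq_square)
  have et: "(l - z) * ((1 - l * (l - 1) / d\<^sup>2) / (x - z) - x * (x - 1) / d / (x - z)\<^sup>2)
      = - l * (l - 1) / d\<^sup>2 + w / (x - z)\<^sup>2"
    using nz by (simp add: divide_simps d_def w_def) (simp add: algebra_simps power2_eq_square)
  have el: "(1 - l * (l - 1) / d\<^sup>2) / d - x * (x - 1) / d / d\<^sup>2
      = - (2 * l - 1) / d\<^sup>2 - 2 * l * (l - 1) / d ^ 3"
    using nz(4) unfolding x
    by (simp add: divide_simps) (simp add: algebra_simps eval_nat_numeral)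
  have "w * (compat_a' z l x * coeff1 z l x + compat_a z l x * coeff1_x z l x)
    = (l - z) * ((1 - l * (l - 1) / d\<^sup>2) / d - x * (x - 1) / d / d\<^sup>2)
      - \<gamma> * (l - z) * ((1 - l * (l - 1) / d\<^sup>2) / x - x * (x - 1) / d / x\<^sup>2)
      - \<delta> * (l - z) * ((1 - l * (l - 1) / d\<^sup>2) / (x - 1) - x * (x - 1) / d / (x - 1)\<^sup>2)
      - \<epsilon> * ((l - z) * ((1 - l * (l - 1) / d\<^sup>2) / (x - z) - x * (x - 1) / d / (x - z)\<^sup>2))"
  proof -
    define A A' where "A = x * (x - 1) / d" and "A' = 1 - l * (l - 1) / d\<^sup>2"
    have "w * compat_a z l x = (l - z) * A" "w * compat_a' z l x = (l - z) * A'"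
      using \<open>w \<noteq> 0\<close> by (simp_all add: compat_a_def compat_a'_def A_def A'_def w_def d_def)
    hence "w * (compat_a' z l x * coeff1 z l x + compat_a z l x * coeff1_x z l x)
        = (l - z) * A' * coeff1 z l x + (l - z) * A * coeff1_x z l x"
      by (simp add: distrib_left mult.assoc[symmetric])
    thus ?thesis
      unfolding coeff1_partial_fractions[OF assms(1)] coeff1_x_def d_def[symmetric]
        A_def[symmetric] A'_def[symmetric]
      by (simp add: divide_inverse algebra_simps)
  qed
  note wa = this[unfolded e0 e1 et el]
  have "w * (coeff1_t z l l' x - (2 * compat_b' z l m x + compat_a'' z l x + compat_a' z l x * coeff1 z l x
       + compat_a z l x * coeff1_x z l x))
     = w * coeff1_t z l l' x - 2 * (w * compat_b' z l m x) - w * compat_a'' z l x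
       - w * (compat_a' z l x * coeff1 z l x + compat_a z l x * coeff1_x z l x)"
    by (simp add: algebra_simps)
  also have "\<dots> = w * ((l' - ham_m z l m) / (x - l)\<^sup>2)"
  proof -
    have *: "w * coeff1_t z l l' x = - \<epsilon> * (w / (x - z)\<^sup>2) + w * l' / d\<^sup>2"
      "w * compat_b' z l m x = cubic z l * m / d\<^sup>2" "w * compat_a'' z l x = 2 * cubic z l / d ^ 3"
      unfolding coeff1_t_def compat_b'_def compat_a''_def w_def[symmetric] d_def[symmetric]
      using \<open>w \<noteq> 0\<close> by (simp_all add: right_diff_distrib)
    have **: "w * ((l' - ham_m z l m) / (x - l)\<^sup>2)
        = (w * l' - (2 * cubic z l * m + drift z l + l * (l - 1))) / d\<^sup>2"
      unfolding ham_m_def w_def[symmetric] d_def[symmetric]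
      using \<open>w \<noteq> 0\<close> by (simp add: right_diff_distrib)
    show ?thesis
      unfolding wa * ** by (simp add: drift_def cubic_def divide_inverse algebra_simps)
  qed
  finally show ?thesis unfolding mult_left_cancel[OF \<open>w \<noteq> 0\<close>] .
qed

section \<open>The second compatibility equation\<close>

lemma cubic_Taylor:
  "cubic z (l + d) = cubic z l + cubic' z l * d + (3 * l - 1 - z) * d\<^sup>2 + d ^ 3"
  by (simp add: cubic_def cubic'_def algebra_simps power2_eq_square power3_eq_cube)

lemma cubic'_Taylor: "cubic' z (l + d) = cubic' z l + 2 * (3 * l - 1 - z) * d + 3 * d\<^sup>2"
  by (simp add: cubic'_def algebra_simps power2_eq_square)

lemma drift_Taylor:
  "drift z (l + d) = drift z l + drift' z l * d + (\<gamma> + \<delta> + \<epsilon> - 3) * d\<^sup>2"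
  by (simp add: drift_def drift'_def algebra_simps power2_eq_square)

text \<open>
The second compatibility equation along the Hamiltonian flow, times \<open>z (z - 1) \<sigma>(x)\<close>, as a
polynomial in \<open>d = x - l\<close> and \<open>i = 1 / d\<close>. The letters stand for \<open>S = \<sigma>(l)\<close>, \<open>S' = \<sigma>'(l)\<close>,
\<open>T = drift z l\<close> with its Taylor coefficients \<open>T', T2\<close> and its \<open>z\<close>-derivative \<open>Tz\<close>, \<open>L = l (l - 1)\<close>,
\<open>L' = 2 l - 1\<close>, \<open>r = l - z\<close> and \<open>w = z (z - 1)\<close>. Treating them as independent apart from the
five relations keeps the expansion small: \<open>\<gamma>, \<delta>, \<epsilon>\<close> enter only through
\<open>T, T', T2, Tz\<close>, which are tied by a single linear relation. The expression is cubic in \<open>m\<close>, and each of its coefficients vanishes.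
\<close>

lemma hamiltonian_flow_identity:
  fixes S S' T T' T2 Tz L L' r w m d i :: complex
  assumes "i * d = 1"
    and "w * Tz = T * (L' - r) + T2 * S - T' * L"
    and "w * L = L * S' - 2 * S * L' + r * S"
    and "S = L * r" and "S' = L + r * L'"
  shows "- (w * (- m * Tz + m\<^sup>2 * L - m * L * i))
   - (- k - m * T' - m\<^sup>2 * S' + m * S' * i + m * S * i\<^sup>2) * (2 * S * m + T + L)
   + (- T - 2 * m * S + S * i) * (S' * m\<^sup>2 + (T' + L') * m + k)
   - ((T + S') * i\<^sup>2 + (T' + 2 * (L' + r)) * i + T2 + 3) * S * m
   + 3 * (S * i ^ 3 + S' * i\<^sup>2 + (L' + r) * i + 1) * S * m
   - (S' * i + 2 * S * i\<^sup>2 + r) * (k * d - m * T - m\<^sup>2 * S + m * S * i)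
   + (S * i + r * L' + r * d) * (k - m * S * i\<^sup>2) = 0"
  using assms by algebra

text \<open>
\<open>Q\<^sub>t\<close> is affine in the velocities \<open>l'\<close> and \<open>m'\<close>, with coefficients \<open>- N\<^sub>\<lambda> / \<sigma>\<close> and \<open>- N\<^sub>\<mu> / \<sigma>\<close>, and
the other terms do not contain them. It therefore suffices that the relation holds for the Hamiltonian
velocities, which is \<open>hamiltonian_flow_identity\<close> after expansion about \<open>x = l\<close>.
\<close>

lemma zeroth_order_residual:
  assumes "cubic z x \<noteq> 0" "x \<noteq> l" "z \<noteq> 0" "z \<noteq> 1"
  shows "cubic z x * (coeff0_t z l m l' m' x + coeff1 z l x * compat_b' z l m x
      - (compat_b'' z l m x + 2 * compat_a' z l x * coeff0 z l m x + compat_a z l x * coeff0_x z l m x))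
    = - (numer_l z l m x * (l' - ham_m z l m) + numer_m z l m x * (m' + ham_l z l m))"
proof -
  define w d i r where "w = z * (z - 1)" and "d = x - l" and "i = 1 / d" and "r = l - z"
  define S S' S2 L L' where "S = cubic z l" and "S' = cubic' z l" and "S2 = 3 * l - 1 - z"
    and "L = l * (l - 1)" and "L' = 2 * l - 1"
  define T T' T2 Tz where "T = drift z l" and "T' = drift' z l" and "T2 = \<gamma> + \<delta> + \<epsilon> - 3"
    and "Tz = drift_t l"
  define N where "N = numer z l m x"
  have nz: "x \<noteq> 0" "x - 1 \<noteq> 0" "x - z \<noteq> 0" "d \<noteq> 0" "w \<noteq> 0" "i * d = 1"
    using assms by (auto simp: cubic_def w_def d_def i_def)
  have x: "x = l + d" by (simp add: d_def)
  have S2: "S2 = L' + r" by (simp add: S2_def L'_def r_def)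
  have div: "y / d = y * i" "y / d\<^sup>2 = y * i\<^sup>2" "y / d ^ 3 = y * i ^ 3" for y
    by (simp_all add: i_def power_divide)
  have wa: "w * compat_a z l x = S * i + r * L' + r * d"
    unfolding compat_a_def w_def[symmetric] d_def[symmetric]
    using nz unfolding x by (simp add: field_simps S_def cubic_def L'_def r_def i_def power2_eq_square)
  have wa': "w * compat_a' z l x = r * (1 - L * i\<^sup>2)"
    unfolding compat_a'_def w_def[symmetric] d_def[symmetric] div L_def[symmetric] r_def[symmetric]
    using nz by simp
  have wb: "w * compat_b' z l m x = S * m * i\<^sup>2" "w * compat_b'' z l m x = - 2 * S * m * i ^ 3"
    unfolding compat_b'_def compat_b''_def w_def[symmetric] d_def[symmetric] S_def[symmetric]
    using nz by (simp_all add: i_def power_divide)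
  have wH: "w * ham_m z l m = 2 * S * m + T + L" "w * ham_l z l m = S' * m\<^sup>2 + (T' + L') * m + k"
    unfolding ham_m_def ham_l_def w_def[symmetric] S_def S'_def T_def T'_def L_def L'_def
    using nz by simp_all
  \<comment> \<open>the coefficient of \<open>N\<close>: its poles at \<open>0, 1, z\<close> cancel, which leaves a polynomial in \<open>i\<close>\<close>
  have rho: "2 * (w * compat_a' z l x) - w * compat_a z l x * (cubic' z x / cubic z x) - w / (x - z)
      = - (S' * i + 2 * S * i\<^sup>2 + r)"
  proof -
    have "cubic' z x / cubic z x = 1 / x + 1 / (x - 1) + 1 / (x - z)"
      using nz by (simp add: cubic_def cubic'_def field_simps)
    moreover have "w * compat_a z l x = r * x * (x - 1) / d"
      unfolding compat_a_def w_def[symmetric] d_def[symmetric] r_def[symmetric] using nz by simp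
    moreover have "r * x * (x - 1) / d * (1 / x + 1 / (x - 1)) = r * (2 * x - 1) / d"
      using nz by (simp add: divide_simps)
    ultimately have "w * compat_a z l x * (cubic' z x / cubic z x) + w / (x - z)
        = r * (2 * x - 1) / d + (r * x * (x - 1) / d / (x - z) + w / (x - z))"
      by (simp add: distrib_left)
    also have "r * x * (x - 1) / d / (x - z) + w / (x - z) = (r * x + (z - 1) * l) / d"
      using nz by (simp add: divide_simps) (simp add: r_def w_def d_def algebra_simps)
    finally have F: "w * compat_a z l x * (cubic' z x / cubic z x) + w / (x - z)
        = r * (2 * x - 1) / d + (r * x + (z - 1) * l) / d" .
    have "2 * (w * compat_a' z l x) - w * compat_a z l x * (cubic' z x / cubic z x) - w / (x - z)
        = 2 * (r * (1 - L / d\<^sup>2)) - (r * (2 * (l + d) - 1) / d + (r * (l + d) + (z - 1) * l) / d)"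
      unfolding wa' diff_diff_add F by (simp add: x i_def power_divide)
    also have "\<dots> = - (S' / d + 2 * S / d\<^sup>2 + r)"
      unfolding S_def S'_def cubic_def cubic'_def L_def r_def
      using nz(4) by (simp add: divide_simps) (simp add: algebra_simps eval_nat_numeral)
    finally show ?thesis unfolding div .
  qed
  have tau: "(drift z x + cubic' z x) * i\<^sup>2 = (T + S') * i\<^sup>2 + (T' + 2 * S2) * i + T2 + 3"
    unfolding x drift_Taylor cubic'_Taylor T_def[symmetric] T'_def[symmetric] T2_def[symmetric]
      S'_def[symmetric] S2_def[symmetric]
    using nz(4) by (simp add: i_def field_simps power2_eq_square)
  have sig: "cubic z x * i ^ 3 = S * i ^ 3 + S' * i\<^sup>2 + S2 * i + 1"
    unfolding x cubic_Taylor S_def[symmetric] S'_def[symmetric] S2_def[symmetric]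
    using nz(4) by (simp add: i_def field_simps power2_eq_square power3_eq_cube)
  have N: "N = k * d - m * T - m\<^sup>2 * S + m * S * i"
    unfolding N_def numer_def d_def[symmetric] T_def S_def div ..
  have Nz: "numer_t l m x = - m * Tz + m\<^sup>2 * L - m * L * i"
    unfolding numer_t_def d_def[symmetric] Tz_def L_def div ..
  have Nl: "numer_l z l m x = - k - m * T' - m\<^sup>2 * S' + m * S' * i + m * S * i\<^sup>2"
    unfolding numer_l_def d_def[symmetric] T'_def S'_def S_def div ..
  have Nm: "numer_m z l m x = - T - 2 * m * S + S * i"
    unfolding numer_m_def d_def[symmetric] T_def S_def div ..
  have c: "cubic z x * coeff0_t z l m l' m' x =
       - (numer_t l m x + numer_l z l m x * l' + numer_m z l m x * m') - N / (x - z)"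
     "cubic z x * coeff0 z l m x = - N"
     "cubic z x * coeff0_x z l m x = - (k - m * S * i\<^sup>2) + N * (cubic' z x / cubic z x)"
     "cubic z x * coeff1 z l x = - (drift z x + cubic' z x) + cubic z x * i"
    using assms(1) unfolding coeff0_t_def coeff0_def coeff0_x_def coeff1_def N_def
      d_def[symmetric] S_def[symmetric] div by (simp_all add: i_def)
  have "w * (cubic z x * (coeff0_t z l m l' m' x + coeff1 z l x * compat_b' z l m x
      - (compat_b'' z l m x + 2 * compat_a' z l x * coeff0 z l m x + compat_a z l x * coeff0_x z l m x)))
    = w * (cubic z x * coeff0_t z l m l' m' x) + cubic z x * coeff1 z l x * (w * compat_b' z l m x)
      - cubic z x * (w * compat_b'' z l m x)
      - 2 * (w * compat_a' z l x) * (cubic z x * coeff0 z l m x)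
      - w * compat_a z l x * (cubic z x * coeff0_x z l m x)"
    by (simp add: algebra_simps)
  also have "\<dots> = - w * (numer_t l m x + numer_l z l m x * l' + numer_m z l m x * m')
      - (drift z x + cubic' z x) * i\<^sup>2 * S * m + 3 * (cubic z x * i ^ 3) * S * m
      + (2 * (w * compat_a' z l x) - w * compat_a z l x * (cubic' z x / cubic z x) - w / (x - z)) * N
      + w * compat_a z l x * (k - m * S * i\<^sup>2)"
    unfolding c wb by (simp add: algebra_simps power2_eq_square power3_eq_cube)
  also have "\<dots> = (- (w * (- m * Tz + m\<^sup>2 * L - m * L * i))
   - (- k - m * T' - m\<^sup>2 * S' + m * S' * i + m * S * i\<^sup>2) * (2 * S * m + T + L)
   + (- T - 2 * m * S + S * i) * (S' * m\<^sup>2 + (T' + L') * m + k)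
   - ((T + S') * i\<^sup>2 + (T' + 2 * (L' + r)) * i + T2 + 3) * S * m
   + 3 * (S * i ^ 3 + S' * i\<^sup>2 + (L' + r) * i + 1) * S * m
   - (S' * i + 2 * S * i\<^sup>2 + r) * (k * d - m * T - m\<^sup>2 * S + m * S * i)
   + (S * i + r * L' + r * d) * (k - m * S * i\<^sup>2))
   - (numer_l z l m x * (w * l' - w * ham_m z l m) + numer_m z l m x * (w * m' + w * ham_l z l m))"
    unfolding rho tau sig
    unfolding wH wa Nz Nl Nm N S2 by (simp add: ring_distribs)
  also have "(- (w * (- m * Tz + m\<^sup>2 * L - m * L * i))
   - (- k - m * T' - m\<^sup>2 * S' + m * S' * i + m * S * i\<^sup>2) * (2 * S * m + T + L)
   + (- T - 2 * m * S + S * i) * (S' * m\<^sup>2 + (T' + L') * m + k)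
   - ((T + S') * i\<^sup>2 + (T' + 2 * (L' + r)) * i + T2 + 3) * S * m
   + 3 * (S * i ^ 3 + S' * i\<^sup>2 + (L' + r) * i + 1) * S * m
   - (S' * i + 2 * S * i\<^sup>2 + r) * (k * d - m * T - m\<^sup>2 * S + m * S * i)
   + (S * i + r * L' + r * d) * (k - m * S * i\<^sup>2)) = 0"
  proof (rule hamiltonian_flow_identity)
    show "i * d = 1" by (fact nz)
    show "w * Tz = T * (L' - r) + T2 * S - T' * L"
      unfolding w_def Tz_def T_def L'_def r_def T2_def S_def T'_def L_def
        drift_def drift'_def drift_t_def cubic_def by (simp add: algebra_simps)
    show "w * L = L * S' - 2 * S * L' + r * S"
      unfolding w_def L_def S'_def S_def L'_def r_def cubic_def cubic'_def
      by (simp add: algebra_simps)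
  qed (simp_all add: S_def S'_def L_def L'_def r_def cubic_def cubic'_def algebra_simps)
  also have "0 - (numer_l z l m x * (w * l' - w * ham_m z l m) + numer_m z l m x * (w * m' + w * ham_l z l m))
    = w * (- (numer_l z l m x * (l' - ham_m z l m) + numer_m z l m x * (m' + ham_l z l m)))"
    by (simp add: algebra_simps)
  finally show ?thesis using nz by simp
qed

section \<open>Compatibility is the Hamiltonian system\<close>

lemma has_field_derivative_drift: "(drift z has_field_derivative drift' z l) (at l)"
  unfolding drift_def drift'_def by (auto intro!: derivative_eq_intros simp: algebra_simps)

lemma has_vector_derivative_drift:
  assumes "(lam has_vector_derivative l') (at t)"
  shows "((\<lambda>s. drift (of_real s) (lam s)) has_vector_derivative
     drift' (of_real t) (lam t) * l' + drift_t (lam t)) (at t)"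
  unfolding drift_def drift'_def drift_t_def
  by (rule has_vector_derivative_eq_rhs, (rule vector_derivative_rules assms)+)
     (simp add: algebra_simps)

lemma hamiltonian_derivs:
  "((\<lambda>l. hamiltonian t l m) has_field_derivative ham_l t l m) (at l)"
  "((\<lambda>m. hamiltonian t l m) has_field_derivative ham_m t l m) (at m)"
  unfolding hamiltonian_def ham_l_def ham_m_def divide_inverse
  by (auto intro!: derivative_eq_intros DERIV_cmult_right has_field_derivative_cubic
      has_field_derivative_drift simp: algebra_simps)

lemma hamiltonian_system_heun_iff:
  "hamiltonian_system hamiltonian I lam mu \<longleftrightarrow>
    (\<forall>t\<in>I. (lam has_vector_derivative ham_m t (lam t) (mu t)) (at t) \<and>
           (mu has_vector_derivative - ham_l t (lam t) (mu t)) (at t))"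
  by (rule hamiltonian_system_iff) (rule hamiltonian_derivs)+

lemma coeff1_has_field_derivative:
  assumes "cubic z x \<noteq> 0" "x \<noteq> l"
  shows "(coeff1 z l has_field_derivative coeff1_x z l x) (at x)"
proof (rule has_field_derivative_transform_within_open)
  show "((\<lambda>x. - (\<gamma> / x + \<delta> / (x - 1) + \<epsilon> / (x - z)) + 1 / (x - l))
      has_field_derivative coeff1_x z l x) (at x)"
    using assms unfolding coeff1_x_def
    by (auto intro!: derivative_eq_intros simp: cubic_eq_0_iff power2_eq_square)
  show "open (- {0, 1, z})" by (intro open_Compl finite_imp_closed) auto
qed (use assms in \<open>auto simp: cubic_eq_0_iff coeff1_partial_fractions\<close>)

lemma coeff1_has_vector_derivative:
  assumes "cubic t x \<noteq> 0" "x \<noteq> lam t" "(lam has_vector_derivative l') (at t)"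
  shows "((\<lambda>s. coeff1 s (lam s) x) has_vector_derivative coeff1_t t (lam t) l' x) (at t)"
proof -
  have nz: "x \<noteq> 0" "x - 1 \<noteq> 0" "x - t \<noteq> 0" "x - lam t \<noteq> 0"
    using assms(1,2) by (auto simp: cubic_eq_0_iff)
  show ?thesis
  proof (rule has_vector_derivative_transform_within_open)
    show "((\<lambda>s. - (\<gamma> / x + \<delta> / (x - 1) + \<epsilon> / (x - of_real s)) + 1 / (x - lam s))
        has_vector_derivative coeff1_t t (lam t) l' x) (at t)"
      unfolding coeff1_t_def
      by (rule has_vector_derivative_eq_rhs, (rule vector_derivative_rules assms(3) nz)+) simp
    show "open (of_real -` (- {x}) :: real set)"
      by (intro open_vimage continuous_intros)
  qed (use assms in \<open>auto simp: cubic_eq_0_iff coeff1_partial_fractions\<close>)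
qed

lemma coeff0_has_field_derivative:
  assumes "cubic z x \<noteq> 0" "x \<noteq> l"
  shows "(coeff0 z l m has_field_derivative coeff0_x z l m x) (at x)"
proof -
  have N: "(numer z l m has_field_derivative k - m * cubic z l / (x - l)\<^sup>2) (at x)"
    unfolding numer_def using assms
    by (auto intro!: derivative_eq_intros simp: power2_eq_square)
  show ?thesis
    unfolding coeff0_def coeff0_x_def
    by (rule derivative_eq_intros N has_field_derivative_cubic assms refl)+
       (use assms in \<open>simp add: field_simps\<close>)
qed

lemma coeff0_has_vector_derivative:
  assumes "cubic t x \<noteq> 0" "x \<noteq> lam t"
    and lam: "(lam has_vector_derivative l') (at t)" and mu: "(mu has_vector_derivative m') (at t)"
  shows "((\<lambda>s. coeff0 s (lam s) (mu s) x) has_vector_derivative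
     coeff0_t t (lam t) (mu t) l' m' x) (at t)"
proof -
  have nz: "x - lam t \<noteq> 0" using assms(2) by simp
  have N: "((\<lambda>s. numer s (lam s) (mu s) x) has_vector_derivative
     numer_t (lam t) (mu t) x + numer_l t (lam t) (mu t) x * l' + numer_m t (lam t) (mu t) x * m') (at t)"
    unfolding numer_def numer_t_def numer_l_def numer_m_def
    by (rule has_vector_derivative_eq_rhs,
        (rule vector_derivative_rules has_vector_derivative_cubic has_vector_derivative_drift lam mu nz)+)
       (use nz in \<open>simp add: divide_simps, simp add: algebra_simps power2_eq_square\<close>)
  have c: "((\<lambda>s. cubic s x) has_vector_derivative - x * (x - 1)) (at t)"
    using has_vector_derivative_cubic[OF has_vector_derivative_const[of x]] by simp
  have *: "n / (x - t) = n * (x * (x - 1)) / cubic t x" for n :: complex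
    using assms(1) by (simp add: cubic_def)
  show ?thesis
    unfolding coeff0_def coeff0_t_def *
    by (rule has_vector_derivative_eq_rhs, (rule vector_derivative_rules N c assms(1))+)
       (use assms(1) in \<open>simp add: field_simps power2_eq_square\<close>)
qed

lemma compat_a_has_field_derivative:
  assumes "x \<noteq> l"
  shows "(compat_a z l has_field_derivative compat_a' z l x) (at x)"
    "(compat_a' z l has_field_derivative compat_a'' z l x) (at x)"
proof -
  have 1: "((\<lambda>x. x * (x - 1) / (x - l)) has_field_derivative 1 - l * (l - 1) / (x - l)\<^sup>2) (at x)"
    using assms by (auto intro!: derivative_eq_intros simp: divide_simps)
      (simp add: algebra_simps power2_eq_square)
  have inv: "((\<lambda>x. c / (x - l)\<^sup>2) has_field_derivative - 2 * c / (x - l) ^ 3) (at x)" for c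
    using assms by (auto intro!: derivative_eq_intros simp: divide_simps eval_nat_numeral)
  have 2: "((\<lambda>x. 1 - l * (l - 1) / (x - l)\<^sup>2) has_field_derivative 2 * l * (l - 1) / (x - l) ^ 3) (at x)"
    using DERIV_diff[OF DERIV_const inv[of "l * (l - 1)"], of 1] by (simp add: mult.assoc)
  show "(compat_a z l has_field_derivative compat_a' z l x) (at x)"
    using DERIV_cmult[OF 1, of "(l - z) / (z * (z - 1))"]
    unfolding compat_a_def compat_a'_def by (simp add: mult.assoc)
  have "(l - z) / (z * (z - 1)) * (2 * l * (l - 1) / (x - l) ^ 3) = compat_a'' z l x"
    unfolding compat_a''_def cubic_def by (simp only: times_divide_times_eq mult_ac)
  thus "(compat_a' z l has_field_derivative compat_a'' z l x) (at x)"
    using DERIV_cmult[OF 2, of "(l - z) / (z * (z - 1))"] unfolding compat_a'_def by simp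
qed

lemma compat_b_has_field_derivative:
  assumes "x \<noteq> l"
  shows "(compat_b z l m has_field_derivative compat_b' z l m x) (at x)"
    "(compat_b' z l m has_field_derivative compat_b'' z l m x) (at x)"
proof -
  have 1: "((\<lambda>x. - 1 / (x - l)) has_field_derivative 1 / (x - l)\<^sup>2) (at x)"
    using assms by (auto intro!: derivative_eq_intros simp: field_simps power2_eq_square)
  have 2: "((\<lambda>x. 1 / (x - l)\<^sup>2) has_field_derivative - 2 / (x - l) ^ 3) (at x)"
    using assms by (auto intro!: derivative_eq_intros simp: divide_simps eval_nat_numeral)
  show "(compat_b z l m has_field_derivative compat_b' z l m x) (at x)"
    using DERIV_cmult[OF 1, of "cubic z l * m / (z * (z - 1))"]
    unfolding compat_b_def compat_b'_def by simp
  show "(compat_b' z l m has_field_derivative compat_b'' z l m x) (at x)"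
    using DERIV_cmult[OF 2, of "cubic z l * m / (z * (z - 1))"]
    unfolding compat_b'_def compat_b''_def by (simp add: mult_ac)
qed

lemma deformed_compatible_at_iff:
  fixes a b P Q :: coeff and lam mu :: "real \<Rightarrow> complex"
  defines "a \<equiv> \<lambda>t. compat_a t (lam t)" and "b \<equiv> \<lambda>t. compat_b t (lam t) (mu t)"
    and "P \<equiv> \<lambda>t. coeff1 t (lam t)" and "Q \<equiv> \<lambda>t. coeff0 t (lam t) (mu t)"
  assumes lam: "(lam has_vector_derivative l') (at t)" and mu: "(mu has_vector_derivative m') (at t)"
    and t: "t \<noteq> 0" "t \<noteq> 1" and x: "cubic t x \<noteq> 0" "x \<noteq> lam t"
  shows "fst (form_dt P Q a b (Q, P)) t x = fst (form_dx P Q (form_dx P Q (b, a))) t x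
       \<and> snd (form_dt P Q a b (Q, P)) t x = snd (form_dx P Q (form_dx P Q (b, a))) t x
     \<longleftrightarrow> l' = ham_m t (lam t) (mu t)
       \<and> numer_l t (lam t) (mu t) x * (l' - ham_m t (lam t) (mu t))
         + numer_m t (lam t) (mu t) x * (m' + ham_l t (lam t) (mu t)) = 0"
proof -
  define X where "X = - {0, 1, of_real t, lam t}"
  have X: "y \<in> X \<longleftrightarrow> cubic t y \<noteq> 0 \<and> y \<noteq> lam t" for y
    by (auto simp: X_def cubic_eq_0_iff)
  have "open X" unfolding X_def by (intro open_Compl finite_imp_closed) auto
  have "x \<in> X" using x X by blast
  have D: "(P t has_field_derivative coeff1_x t (lam t) y) (at y)"
    "(Q t has_field_derivative coeff0_x t (lam t) (mu t) y) (at y)"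
    "(a t has_field_derivative compat_a' t (lam t) y) (at y)"
    "(compat_a' t (lam t) has_field_derivative compat_a'' t (lam t) y) (at y)"
    "(b t has_field_derivative compat_b' t (lam t) (mu t) y) (at y)"
    "(compat_b' t (lam t) (mu t) has_field_derivative compat_b'' t (lam t) (mu t) y) (at y)"
    if "y \<in> X" for y
    using that X unfolding P_def Q_def a_def b_def
    by (auto intro!: coeff1_has_field_derivative coeff0_has_field_derivative
        compat_a_has_field_derivative compat_b_has_field_derivative)
  have hol: "P t holomorphic_on X" "Q t holomorphic_on X" "a t holomorphic_on X" "b t holomorphic_on X"
    unfolding holomorphic_on_def field_differentiable_def
    using D has_field_derivative_at_within by blast+
  have cancel: "(L = R) = (E = 0)" if "c * (L - R) = - E" "c \<noteq> 0" for c L R E :: complex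
    using that by auto
  have dd: "deriv (deriv (a t)) x = compat_a'' t (lam t) x"
    "deriv (deriv (b t)) x = compat_b'' t (lam t) (mu t) x"
    by (rule deriv_deriv_eq[where f = "a t" and f' = "compat_a' t (lam t)"]
          deriv_deriv_eq[where f = "b t" and f' = "compat_b' t (lam t) (mu t)"],
        rule \<open>open X\<close>, rule \<open>x \<in> X\<close>, erule D, rule D, rule \<open>x \<in> X\<close>)+
  note d = D[OF \<open>x \<in> X\<close>, THEN DERIV_imp_deriv]
  have Pt: "vector_derivative (\<lambda>s. P s x) (at t) = coeff1_t t (lam t) l' x"
    unfolding P_def by (rule vector_derivative_at coeff1_has_vector_derivative x lam)+
  have Qt: "vector_derivative (\<lambda>s. Q s x) (at t) = coeff0_t t (lam t) (mu t) l' m' x"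
    unfolding Q_def by (rule vector_derivative_at coeff0_has_vector_derivative x lam mu)+
  have z: "complex_of_real t \<noteq> 0" "complex_of_real t \<noteq> 1" using t by auto
  note r1 = first_order_residual[OF x z, of l' "mu t"]
  note r0 = zeroth_order_residual[OF x z, of "mu t" l' m']
  have "vector_derivative (\<lambda>s. P s x) (at t)
         = 2 * deriv (b t) x + deriv (deriv (a t)) x + deriv (a t) x * P t x + a t x * deriv (P t) x
     \<longleftrightarrow> l' = ham_m t (lam t) (mu t)"
    unfolding Pt dd d unfolding P_def a_def
    by (subst eq_iff_diff_eq_0, subst r1) (use x(2) in simp)
  moreover have "vector_derivative (\<lambda>s. Q s x) (at t) + P t x * deriv (b t) x
         = deriv (deriv (b t)) x + 2 * deriv (a t) x * Q t x + a t x * deriv (Q t) x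
     \<longleftrightarrow> numer_l t (lam t) (mu t) x * (l' - ham_m t (lam t) (mu t))
         + numer_m t (lam t) (mu t) x * (m' + ham_l t (lam t) (mu t)) = 0"
    unfolding Qt dd d unfolding P_def Q_def a_def
    by (rule cancel[OF r0 x(1)])
  ultimately show ?thesis
    unfolding compatible_at_iff[where P = P and Q = Q and a = a and b = b and t = t,
        OF \<open>open X\<close> \<open>x \<in> X\<close> hol]
    by (rule conj_cong)
qed

text \<open>
\<open>numer_m\<close> has a pole at \<open>l\<close>, hence it is not constantly zero. At a point where it does not vanish,
the second compatibility equation determines \<open>\<mu>'\<close>.
\<close>

lemma numer_m_nonzero_somewhere:
  assumes "cubic z l \<noteq> 0"
  obtains x where "cubic z x \<noteq> 0" "x \<noteq> l" "numer_m z l m x \<noteq> 0"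
proof -
  have inj: "inj_on (\<lambda>x. cubic z l / (x - l)) (- {l})"
    using assms by (auto simp: inj_on_def divide_simps)
  have "finite {x. x \<noteq> l \<and> cubic z l / (x - l) = drift z l + 2 * m * cubic z l}" (is "finite ?B")
  proof (cases "?B = {}")
    case False
    then obtain x0 where "x0 \<in> ?B" by auto
    hence "?B \<subseteq> {x0}" using inj_onD[OF inj, of _ x0] by auto
    thus ?thesis by (rule finite_subset) simp
  next
    case True
    show ?thesis unfolding True by (rule finite.emptyI)
  qed
  hence "finite (?B \<union> {0, 1, z, l})" by simp
  then obtain x where x: "x \<notin> ?B \<union> {0, 1, z, l}"
    using infinite_UNIV_char_0[where 'a = complex] by (metis ex_new_if_finite)
  have "numer_m z l m x = cubic z l / (x - l) - (drift z l + 2 * m * cubic z l)"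
    by (simp add: numer_m_def)
  with x show ?thesis
    by (intro that[of x]) (auto simp: cubic_eq_0_iff)
qed

definition sigma_poly :: "real \<Rightarrow> complex poly" where
  "sigma_poly t = [:0, 1:] * [:-1, 1:] * [:- of_real t, 1:]"

definition tau_poly :: "real \<Rightarrow> complex poly" where
  "tau_poly t = smult \<gamma> ([:-1, 1:] * [:- of_real t, 1:]) + smult \<delta> ([:0, 1:] * [:- of_real t, 1:])
     + smult \<epsilon> ([:0, 1:] * [:-1, 1:])"

lemma poly_sigma: "poly (sigma_poly t) x = cubic t x"
  by (simp add: sigma_poly_def cubic_def algebra_simps)

lemma poly_pderiv_sigma: "poly (pderiv (sigma_poly t)) x = cubic' t x"
  by (simp add: sigma_poly_def cubic'_def pderiv_mult pderiv_pCons algebra_simps)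

lemma poly_tau: "poly (tau_poly t) x = drift t x + cubic' t x"
  by (simp add: tau_poly_def cubic'_def drift_def algebra_simps)

lemma deformed_coeffs:
  "- deformed_coeff1 (sigma_poly t) (tau_poly t) l x / poly (sigma_poly t) x = coeff1 t l x"
  "- deformed_coeff0 (sigma_poly t) (tau_poly t) [:h, k:] l m x / poly (sigma_poly t) x = coeff0 t l m x"
  by (simp_all add: deformed_coeff1_def deformed_coeff0_def coeff1_def coeff0_def numer_def
      poly_sigma poly_pderiv_sigma poly_tau algebra_simps)

lemma deformed_compatible_iff_hamiltonian_system:
  assumes I: "0 \<notin> I" "1 \<notin> I"
    and "\<And>t. t \<in> I \<Longrightarrow> lam differentiable (at t)" "\<And>t. t \<in> I \<Longrightarrow> mu differentiable (at t)"
    and reg: "\<And>t. t \<in> I \<Longrightarrow> cubic t (lam t) \<noteq> 0"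
  shows "deformed_compatible sigma_poly tau_poly (\<lambda>t. [:h t, k:]) I lam mu
      (\<lambda>t. compat_a t (lam t)) (\<lambda>t. compat_b t (lam t) (mu t))
    \<longleftrightarrow> hamiltonian_system hamiltonian I lam mu"
proof -
  define l' m' where "l' = (\<lambda>t. vector_derivative lam (at t))" and "m' = (\<lambda>t. vector_derivative mu (at t))"
  have lam: "(lam has_vector_derivative l' t) (at t)" and mu: "(mu has_vector_derivative m' t) (at t)"
    if "t \<in> I" for t
    using that assms by (auto simp: l'_def m'_def vector_derivative_works[symmetric])
  have nz: "t \<noteq> 0" "t \<noteq> 1" if "t \<in> I" for t using that I by auto
  have hol: "coeff1 t l holomorphic_on {x. cubic t x \<noteq> 0 \<and> x \<noteq> l}"
    "coeff0 t l m holomorphic_on {x. cubic t x \<noteq> 0 \<and> x \<noteq> l}"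
    "compat_a t l holomorphic_on {x. cubic t x \<noteq> 0 \<and> x \<noteq> l}"
    "compat_b t l m holomorphic_on {x. cubic t x \<noteq> 0 \<and> x \<noteq> l}" for t l m
    unfolding holomorphic_on_def field_differentiable_def
    by (blast intro: has_field_derivative_at_within coeff1_has_field_derivative
        coeff0_has_field_derivative compat_a_has_field_derivative compat_b_has_field_derivative)+
  have diff: "(\<lambda>s. coeff1 s (lam s) x) differentiable (at t)"
    "(\<lambda>s. coeff0 s (lam s) (mu s) x) differentiable (at t)"
    if "t \<in> I" "cubic t x \<noteq> 0" "x \<noteq> lam t" for t x
    using coeff1_has_vector_derivative[OF that(2,3) lam[OF that(1)]]
      coeff0_has_vector_derivative[OF that(2,3) lam[OF that(1)] mu[OF that(1)]]
    by (auto intro: differentiableI_vector)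
  define X P Q a b where "X = (\<lambda>t. {x. cubic (of_real t) x \<noteq> 0 \<and> x \<noteq> lam t})"
    and "P = (\<lambda>t::real. coeff1 t (lam t))" and "Q = (\<lambda>t::real. coeff0 t (lam t) (mu t))"
    and "a = (\<lambda>t::real. compat_a t (lam t))" and "b = (\<lambda>t::real. compat_b t (lam t) (mu t))"
  have "deformed_compatible sigma_poly tau_poly (\<lambda>t. [:h t, k:]) I lam mu a b
    \<longleftrightarrow> compatible I X P Q a b"
    unfolding deformed_compatible_def deformed_coeffs unfolding poly_sigma X_def P_def Q_def ..
  also have "\<dots> \<longleftrightarrow> (\<forall>t\<in>I. \<forall>x\<in>X t.
        fst (form_dt P Q a b (Q, P)) t x = fst (form_dx P Q (form_dx P Q (b, a))) t x
      \<and> snd (form_dt P Q a b (Q, P)) t x = snd (form_dx P Q (form_dx P Q (b, a))) t x)"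
  proof -
    have "\<forall>t\<in>I. P t holomorphic_on X t \<and> Q t holomorphic_on X t
        \<and> a t holomorphic_on X t \<and> b t holomorphic_on X t"
      unfolding P_def Q_def a_def b_def X_def using hol by blast
    moreover have "\<forall>t\<in>I. \<forall>x\<in>X t. (\<lambda>s. P s x) differentiable (at t) \<and> (\<lambda>s. Q s x) differentiable (at t)"
      unfolding P_def Q_def X_def using diff by blast
    ultimately show ?thesis unfolding compatible_def by blast
  qed
  also have "\<dots> \<longleftrightarrow> (\<forall>t\<in>I. \<forall>x\<in>X t. l' t = ham_m t (lam t) (mu t)
         \<and> numer_l t (lam t) (mu t) x * (l' t - ham_m t (lam t) (mu t))
           + numer_m t (lam t) (mu t) x * (m' t + ham_l t (lam t) (mu t)) = 0)"
    unfolding P_def Q_def a_def b_def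
    by (intro ball_cong refl deformed_compatible_at_iff lam mu nz) (auto simp: X_def)
  also have "\<dots> \<longleftrightarrow> (\<forall>t\<in>I. l' t = ham_m t (lam t) (mu t) \<and> m' t = - ham_l t (lam t) (mu t))"
  proof (intro ball_cong refl iffI)
    fix t assume t: "t \<in> I"
      and *: "\<forall>x\<in>X t. l' t = ham_m t (lam t) (mu t)
         \<and> numer_l t (lam t) (mu t) x * (l' t - ham_m t (lam t) (mu t))
           + numer_m t (lam t) (mu t) x * (m' t + ham_l t (lam t) (mu t)) = 0"
    obtain x where "cubic t x \<noteq> 0" "x \<noteq> lam t" "numer_m t (lam t) (mu t) x \<noteq> 0"
      using numer_m_nonzero_somewhere[OF reg[OF t]] by metis
    with * show "l' t = ham_m t (lam t) (mu t) \<and> m' t = - ham_l t (lam t) (mu t)"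
      by (auto simp: X_def eq_neg_iff_add_eq_0)
  qed auto
  also have "\<dots> \<longleftrightarrow> hamiltonian_system hamiltonian I lam mu"
    unfolding hamiltonian_system_heun_iff
  proof (intro ball_cong refl)
    fix t assume t: "t \<in> I"
    have "(f has_vector_derivative y) (at t) \<longleftrightarrow> v = y" if "(f has_vector_derivative v) (at t)"
      for f :: "real \<Rightarrow> complex" and v y
      using that vector_derivative_unique_at by blast
    from this[OF lam[OF t]] this[OF mu[OF t]]
    show "(l' t = ham_m t (lam t) (mu t) \<and> m' t = - ham_l t (lam t) (mu t)) \<longleftrightarrow>
      (lam has_vector_derivative ham_m t (lam t) (mu t)) (at t) \<and>
      (mu has_vector_derivative - ham_l t (lam t) (mu t)) (at t)" by simp
  qed
  finally show ?thesis unfolding a_def b_def .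
qed

section \<open>Elimination of the momentum\<close>

lemma ham_m_has_vector_derivative:
  assumes lam: "(lam has_vector_derivative p) (at t)" and mu: "(mu has_vector_derivative q) (at t)"
    and t: "t \<noteq> 0" "t \<noteq> 1"
  shows "((\<lambda>s. ham_m s (lam s) (mu s)) has_vector_derivative
    (2 * (cubic' t (lam t) * p - lam t * (lam t - 1)) * mu t + 2 * cubic t (lam t) * q
       + (drift' t (lam t) + 2 * lam t - 1) * p + drift_t (lam t)
       - (2 * of_real t - 1) * ham_m t (lam t) (mu t)) / (of_real t * (of_real t - 1))) (at t)"
proof -
  have w: "complex_of_real t * (complex_of_real t - 1) \<noteq> 0" using t by auto
  show ?thesis
    unfolding ham_m_def
    by (rule has_vector_derivative_eq_rhs,
        (rule vector_derivative_rules has_vector_derivative_cubic has_vector_derivative_drift lam mu w)+)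
       (use t in \<open>simp add: divide_simps, simp add: algebra_simps power2_eq_square\<close>)
qed

text \<open>
The left-hand side is half the derivative of \<open>\<sigma> g\<^sup>2\<close> with respect to \<open>l\<close>. As \<open>\<sigma>\<close> has simple
zeros where \<open>g\<close> has simple poles, \<open>\<sigma> g\<^sup>2\<close> has at most simple poles at \<open>0, 1, z\<close> and grows linearly with
slope \<open>(\<gamma> + \<delta> + \<epsilon> - 2)\<^sup>2\<close>; the derivative of its partial fraction expansion is the right-hand
side, which is already the shape of the Painleve VI potential.
\<close>

lemma painleve_potential:
  assumes "cubic z l \<noteq> 0"
  defines "g \<equiv> (\<gamma> - 1) / l + (\<delta> - 1) / (l - 1) + \<epsilon> / (l - z)"
  shows "cubic' z l * g\<^sup>2 / 2
      - cubic z l * g * ((\<gamma> - 1) / l\<^sup>2 + (\<delta> - 1) / (l - 1)\<^sup>2 + \<epsilon> / (l - z)\<^sup>2)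
    = ((\<gamma> + \<delta> + \<epsilon> - 2)\<^sup>2 - (\<gamma> - 1)\<^sup>2 * z / l\<^sup>2 + (\<delta> - 1)\<^sup>2 * (z - 1) / (l - 1)\<^sup>2
       - \<epsilon>\<^sup>2 * (z * (z - 1)) / (l - z)\<^sup>2) / 2"
proof -
  define u v w where "u = 1 / l" and "v = 1 / (l - 1)" and "w = 1 / (l - z)"
  have nz: "l \<noteq> 0" "l - 1 \<noteq> 0" "l - z \<noteq> 0" using assms(1) by (auto simp: cubic_def)
  have uv: "l * u = 1" "(l - 1) * v = 1" "(l - z) * w = 1"
    using nz by (simp_all add: u_def v_def w_def)
  have sq: "cubic' z l * u\<^sup>2 - 2 * cubic z l * u ^ 3 = 1 - z * u\<^sup>2"
    "cubic' z l * v\<^sup>2 - 2 * cubic z l * v ^ 3 = 1 + (z - 1) * v\<^sup>2"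
    "cubic' z l * w\<^sup>2 - 2 * cubic z l * w ^ 3 = 1 - z * (z - 1) * w\<^sup>2"
    unfolding cubic_def cubic'_def using uv by algebra+
  have mixed: "cubic' z l * (u * v) - cubic z l * (u * v) * (u + v) = 1"
    "cubic' z l * (u * w) - cubic z l * (u * w) * (u + w) = 1"
    "cubic' z l * (v * w) - cubic z l * (v * w) * (v + w) = 1"
    unfolding cubic_def cubic'_def using uv by algebra+
  have "2 * (cubic' z l * g\<^sup>2 / 2
      - cubic z l * g * ((\<gamma> - 1) / l\<^sup>2 + (\<delta> - 1) / (l - 1)\<^sup>2 + \<epsilon> / (l - z)\<^sup>2))
    = cubic' z l * ((\<gamma> - 1) * u + (\<delta> - 1) * v + \<epsilon> * w)\<^sup>2 - 2 * cubic z l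
      * ((\<gamma> - 1) * u + (\<delta> - 1) * v + \<epsilon> * w) * ((\<gamma> - 1) * u\<^sup>2 + (\<delta> - 1) * v\<^sup>2 + \<epsilon> * w\<^sup>2)"
    by (simp add: g_def u_def v_def w_def power_divide)
  also have "\<dots> = (\<gamma> - 1)\<^sup>2 * (cubic' z l * u\<^sup>2 - 2 * cubic z l * u ^ 3)
      + (\<delta> - 1)\<^sup>2 * (cubic' z l * v\<^sup>2 - 2 * cubic z l * v ^ 3)
      + \<epsilon>\<^sup>2 * (cubic' z l * w\<^sup>2 - 2 * cubic z l * w ^ 3)
      + 2 * (\<gamma> - 1) * (\<delta> - 1) * (cubic' z l * (u * v) - cubic z l * (u * v) * (u + v))
      + 2 * (\<gamma> - 1) * \<epsilon> * (cubic' z l * (u * w) - cubic z l * (u * w) * (u + w))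
      + 2 * (\<delta> - 1) * \<epsilon> * (cubic' z l * (v * w) - cubic z l * (v * w) * (v + w))"
    by algebra
  also have "\<dots> = (\<gamma> + \<delta> + \<epsilon> - 2)\<^sup>2 - (\<gamma> - 1)\<^sup>2 * z * u\<^sup>2 + (\<delta> - 1)\<^sup>2 * (z - 1) * v\<^sup>2
       - \<epsilon>\<^sup>2 * (z * (z - 1)) * w\<^sup>2"
    unfolding sq mixed by algebra
  also have "\<dots> = (\<gamma> + \<delta> + \<epsilon> - 2)\<^sup>2 - (\<gamma> - 1)\<^sup>2 * z / l\<^sup>2 + (\<delta> - 1)\<^sup>2 * (z - 1) / (l - 1)\<^sup>2
       - \<epsilon>\<^sup>2 * (z * (z - 1)) / (l - z)\<^sup>2"
    by (simp add: u_def v_def w_def power_divide)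
  finally show ?thesis by (simp add: field_simps)
qed

text \<open>
In terms of the local exponents of the deformed equation: \<open>2 P6_A\<close>, \<open>- 2 P6_B\<close>, \<open>2 P6_C\<close> and
\<open>1 - 2 P6_D\<close> are the squared exponent differences at \<open>\<infinity>\<close>, \<open>0\<close>, \<open>1\<close> and \<open>t\<close>.
\<close>

definition P6_A :: complex where "P6_A = ((\<gamma> + \<delta> + \<epsilon> - 2)\<^sup>2 - 4 * k) / 2"
definition P6_B :: complex where "P6_B = - (\<gamma> - 1)\<^sup>2 / 2"
definition P6_C :: complex where "P6_C = (\<delta> - 1)\<^sup>2 / 2"
definition P6_D :: complex where "P6_D = (1 - (\<epsilon> - 1)\<^sup>2) / 2"

text \<open>
The right-hand side is \<open>\<lambda>''\<close> as computed from Hamilton's equations (see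
\<open>ham_m_has_vector_derivative\<close>). Write \<open>G = \<sigma> g\<close> for the coefficient of \<open>\<mu>\<close> in \<open>t (t - 1) H\<close> and
\<open>v = t (t - 1) p\<close>, so that \<open>2 \<sigma>(\<lambda>) \<mu> = v - G\<close>. Substituting this, the terms
quadratic and linear in \<open>v\<close> are immediately those of Painleve VI, and the remaining term is \<open>\<sigma>\<close> times
the expression in \<open>painleve_potential\<close>, up to the contributions of \<open>k\<close> and of \<open>\<epsilon>\<close> from the
explicit dependence on \<open>t\<close>.
\<close>

lemma painleve_identity:
  assumes "cubic z l \<noteq> 0" "z \<noteq> 0" "z \<noteq> 1" and p: "p = ham_m z l m"
  shows "1/2 * (1/l + 1/(l - 1) + 1/(l - z)) * p\<^sup>2
      - (1/z + 1/(z - 1) + 1/(l - z)) * p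
      + l * (l - 1) * (l - z) / (z\<^sup>2 * (z - 1)\<^sup>2)
        * (P6_A + P6_B * z / l\<^sup>2 + P6_C * (z - 1) / (l - 1)\<^sup>2 + P6_D * z * (z - 1) / (l - z)\<^sup>2)
    = (2 * (cubic' z l * p - l * (l - 1)) * m + 2 * cubic z l * (- ham_l z l m)
       + (drift' z l + 2 * l - 1) * p + drift_t l - (2 * z - 1) * p) / (z * (z - 1))"
    (is "?lhs = ?rhs")
proof -
  define w v S S' L where "w = z * (z - 1)" and "v = w * p" and "S = cubic z l"
    and "S' = cubic' z l" and "L = l * (l - 1)"
  define G G' Gz where "G = drift z l + L" and "G' = drift' z l + 2 * l - 1" and "Gz = drift_t l"
  define g g' where "g = (\<gamma> - 1) / l + (\<delta> - 1) / (l - 1) + \<epsilon> / (l - z)"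
    and "g' = - ((\<gamma> - 1) / l\<^sup>2 + (\<delta> - 1) / (l - 1)\<^sup>2 + \<epsilon> / (l - z)\<^sup>2)"
  define V where "V = P6_A + P6_B * z / l\<^sup>2 + P6_C * (z - 1) / (l - 1)\<^sup>2 + P6_D * z * (z - 1) / (l - z)\<^sup>2"
  have nz: "l \<noteq> 0" "l - 1 \<noteq> 0" "l - z \<noteq> 0" "w \<noteq> 0" "S \<noteq> 0" "z \<noteq> 0" "z - 1 \<noteq> 0"
    using assms(1-3) by (auto simp: cubic_def w_def S_def)
  have Sm: "2 * S * m = v - G"
    using nz by (simp add: v_def p ham_m_def S_def G_def L_def w_def)
  have wHl: "w * ham_l z l m = S' * m\<^sup>2 + G' * m + k"
    unfolding ham_l_def w_def[symmetric] S'_def G'_def using nz(4) by (simp add: add_diff_eq)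
  have S': "S' = S * (1/l + 1/(l - 1) + 1/(l - z))"
    using nz by (simp add: S_def S'_def cubic_def cubic'_def field_simps)
  have G: "G = S * g"
    using nz by (simp add: G_def S_def L_def g_def cubic_def drift_def divide_simps)
      (simp add: algebra_simps)
  have G': "G' = S' * g + S * g'"
    using nz unfolding g_def g'_def
    by (simp add: G'_def S_def S'_def cubic_def cubic'_def drift'_def divide_simps)
      (simp add: algebra_simps power2_eq_square)
  have L: "L = S / (l - z)" using nz by (simp add: S_def L_def cubic_def)
  have Gz: "Gz = - L * g + S * \<epsilon> / (l - z)\<^sup>2"
    using nz by (simp add: Gz_def L_def g_def S_def cubic_def drift_t_def divide_simps)
      (simp add: algebra_simps power2_eq_square)
  have V: "V = S' * g\<^sup>2 / 2 + S * g * g' - 2 * k + w * \<epsilon> / (l - z)\<^sup>2"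
  proof -
    define u0 u1 ut where "u0 = 1 / l\<^sup>2" and "u1 = 1 / (l - 1)\<^sup>2" and "ut = 1 / (l - z)\<^sup>2"
    have div: "x / l\<^sup>2 = x * u0" "x / (l - 1)\<^sup>2 = x * u1" "x / (l - z)\<^sup>2 = x * ut" for x
      by (simp_all add: u0_def u1_def ut_def)
    have "S' * g\<^sup>2 / 2 + S * g * g' = ((\<gamma> + \<delta> + \<epsilon> - 2)\<^sup>2 - (\<gamma> - 1)\<^sup>2 * z / l\<^sup>2
        + (\<delta> - 1)\<^sup>2 * (z - 1) / (l - 1)\<^sup>2 - \<epsilon>\<^sup>2 * w / (l - z)\<^sup>2) / 2"
      using painleve_potential[OF assms(1), folded g_def S_def S'_def w_def]
      by (simp only: g'_def mult_minus_right add_uminus_conv_diff)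
    thus ?thesis
      unfolding V_def P6_A_def P6_B_def P6_C_def P6_D_def w_def div
      by (simp add: algebra_simps power2_eq_square add_divide_distrib diff_divide_distrib)
  qed
  have w2: "w\<^sup>2 * (X / w) = w * X" for X
    using nz(4) by (simp add: power2_eq_square)
  have "w\<^sup>2 * ?rhs = w * (2 * (S' * p - L) * m + G' * p + Gz - (2 * z - 1) * p) - 2 * S * (w * ham_l z l m)"
    unfolding w_def[symmetric] S_def[symmetric] S'_def[symmetric] L_def[symmetric]
      Gz_def[symmetric] G'_def w2 by (simp add: algebra_simps)
  also have "\<dots> = 2 * S' * v * m - 2 * w * L * m + G' * v + w * Gz - (2 * z - 1) * v
      - m * S' * (2 * S * m) - G' * (2 * S * m) - 2 * S * k"
    unfolding wHl v_def by (simp add: power2_eq_square algebra_simps)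
  finally have R: "w\<^sup>2 * ?rhs = 2 * S' * v * m - 2 * w * L * m + G' * v + w * Gz - (2 * z - 1) * v
      - m * S' * (2 * S * m) - G' * (2 * S * m) - 2 * S * k" .
  have "S * (w\<^sup>2 * ?rhs) = S' * v * (2 * S * m) - w * L * (2 * S * m) - S' * (2 * S * m)\<^sup>2 / 2
      + S * (G' * v + w * Gz - (2 * z - 1) * v - G' * (2 * S * m) - 2 * S * k)"
    unfolding R by (simp add: algebra_simps power2_eq_square)
  also have "\<dots> = S' * v\<^sup>2 / 2 - w * L * v
      + S * (S * V - (2 * z - 1) * v)"
    unfolding Sm V Gz G' G by (simp add: algebra_simps power2_eq_square add_divide_distrib diff_divide_distrib)
  also have "\<dots> = S * ((1/l + 1/(l - 1) + 1/(l - z)) * v\<^sup>2 / 2 - w / (l - z) * v - (2 * z - 1) * v + S * V)"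
    unfolding S' L by (simp add: algebra_simps)
  finally have "w\<^sup>2 * ?rhs = (1/l + 1/(l - 1) + 1/(l - z)) * v\<^sup>2 / 2 - w / (l - z) * v - (2 * z - 1) * v + S * V"
    unfolding mult_left_cancel[OF nz(5)] .
  also have "\<dots> = w\<^sup>2 * ?lhs"
  proof -
    have e1: "w\<^sup>2 * (1/z + 1/(z - 1)) * p = (2 * z - 1) * v"
      using nz by (simp add: v_def w_def field_simps power2_eq_square)
    have e2: "w\<^sup>2 * (l * (l - 1) * (l - z) / (z\<^sup>2 * (z - 1)\<^sup>2)) = S"
      using nz by (simp add: w_def S_def cubic_def power_mult_distrib)
    have e3: "w\<^sup>2 * (1/2 * X * p\<^sup>2 - (Y + e) * p + c * V)
        = X * v\<^sup>2 / 2 - w * e * v - w\<^sup>2 * Y * p + w\<^sup>2 * c * V" for X Y e c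
      by (simp add: v_def algebra_simps power2_eq_square)
    show ?thesis unfolding V_def[symmetric] e3 e1 e2 by simp
  qed
  finally have "w\<^sup>2 * ?rhs = w\<^sup>2 * ?lhs" .
  moreover have "w\<^sup>2 \<noteq> 0" using nz(4) by simp
  ultimately show ?thesis by (metis mult_left_cancel)
qed

lemma hamiltonian_system_imp_P6:
  assumes "0 \<notin> I" "1 \<notin> I" and reg: "\<And>t. t \<in> I \<Longrightarrow> cubic t (lam t) \<noteq> 0"
    and ham: "hamiltonian_system hamiltonian I lam mu"
  shows "solves_P6 P6_A P6_B P6_C P6_D I lam"
proof -
  have H: "(lam has_vector_derivative ham_m t (lam t) (mu t)) (at t)"
     "(mu has_vector_derivative - ham_l t (lam t) (mu t)) (at t)" if "t \<in> I" for t
    using ham that unfolding hamiltonian_system_heun_iff by auto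
  have t: "t \<noteq> 0" "t \<noteq> 1" "complex_of_real t \<noteq> 0" "complex_of_real t \<noteq> 1" if "t \<in> I" for t
    using that assms(1,2) by auto
  have "lam t \<notin> {0, 1, of_real t}" if "t \<in> I" for t
    using reg[OF that] by (auto simp: cubic_eq_0_iff)
  thus ?thesis
    unfolding solves_P6_def Let_def
    using H ham_m_has_vector_derivative[OF H t(1,2)] painleve_identity[OF reg t(3,4) refl]
    by (intro exI[of _ "\<lambda>t. ham_m t (lam t) (mu t)"] exI ballI conjI) (assumption | simp)+
qed

text \<open>
The momentum has to be the solution of \<open>\<lambda>' = H\<^sub>\<mu>\<close>. Differentiating this equation once
gives \<open>\<lambda>''\<close> as an affine function of \<open>\<mu>'\<close> with nonzero slope; by \<open>painleve_identity\<close> it has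
the value that Painleve VI prescribes exactly when \<open>\<mu>' = - H\<^sub>\<lambda>\<close>.
\<close>

lemma P6_imp_hamiltonian_system:
  assumes "open I" "0 \<notin> I" "1 \<notin> I" and reg: "\<And>t. t \<in> I \<Longrightarrow> cubic t (lam t) \<noteq> 0"
    and P6: "solves_P6 P6_A P6_B P6_C P6_D I lam"
  obtains mu where "hamiltonian_system hamiltonian I lam mu"
proof -
  obtain y' y'' where y': "(lam has_vector_derivative y' t) (at t)"
      and y'': "(y' has_vector_derivative y'' t) (at t)"
      and eq: "y'' t = 1/2 * (1/lam t + 1/(lam t - 1) + 1/(lam t - t)) * (y' t)\<^sup>2
                - (1/t + 1/(complex_of_real t - 1) + 1/(lam t - t)) * y' t
                + lam t * (lam t - 1) * (lam t - t) / ((of_real t)\<^sup>2 * (complex_of_real t - 1)\<^sup>2)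
                  * (P6_A + P6_B * t / (lam t)\<^sup>2 + P6_C * (complex_of_real t - 1) / (lam t - 1)\<^sup>2
                       + P6_D * t * (complex_of_real t - 1) / (lam t - t)\<^sup>2)"
    if "t \<in> I" for t
    using P6 unfolding solves_P6_def Let_def by blast
  define mu where "mu = (\<lambda>t::real. (t * (complex_of_real t - 1) * y' t - drift t (lam t) - lam t * (lam t - 1))
      / (2 * cubic t (lam t)))"
  have nz: "t \<noteq> 0" "t \<noteq> 1" "complex_of_real t \<noteq> 0" "complex_of_real t \<noteq> 1" if "t \<in> I" for t
    using that assms(2,3) by auto
  have p: "y' t = ham_m t (lam t) (mu t)" if "t \<in> I" for t
    using nz[OF that] reg[OF that] by (simp add: mu_def ham_m_def field_simps)
  have "(mu has_vector_derivative - ham_l t (lam t) (mu t)) (at t)" if t: "t \<in> I" for t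
  proof -
    define M where "M = vector_derivative mu (at t)"
    have c: "2 * cubic t (lam t) \<noteq> 0" using reg[OF t] by simp
    have "\<exists>D. (mu has_vector_derivative D) (at t)"
      unfolding mu_def
      by (rule exI, (rule vector_derivative_rules has_vector_derivative_cubic
        has_vector_derivative_drift y'[OF t] y''[OF t] c)+)
    hence M: "(mu has_vector_derivative M) (at t)"
      unfolding M_def by (metis vector_derivative_at)
    note D = ham_m_has_vector_derivative[OF y'[OF t] M nz(1,2)[OF t]]
    have "(y' has_vector_derivative
       (2 * (cubic' t (lam t) * y' t - lam t * (lam t - 1)) * mu t + 2 * cubic t (lam t) * M
       + (drift' t (lam t) + 2 * lam t - 1) * y' t + drift_t (lam t)
       - (2 * of_real t - 1) * ham_m t (lam t) (mu t)) / (of_real t * (of_real t - 1))) (at t)"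
      by (rule has_vector_derivative_transform_within_open[OF D \<open>open I\<close> t]) (simp add: p)
    hence "y'' t = (2 * (cubic' t (lam t) * y' t - lam t * (lam t - 1)) * mu t + 2 * cubic t (lam t) * M
       + (drift' t (lam t) + 2 * lam t - 1) * y' t + drift_t (lam t)
       - (2 * of_real t - 1) * y' t) / (of_real t * (of_real t - 1))"
      using vector_derivative_unique_at[OF y''[OF t]] p[OF t] by simp
    also note eq[OF t, unfolded painleve_identity[OF reg[OF t] nz(3,4)[OF t] p[OF t]]]
    finally have "2 * cubic t (lam t) * M = 2 * cubic t (lam t) * (- ham_l t (lam t) (mu t))"
      using nz[OF t] by simp
    hence "M = - ham_l t (lam t) (mu t)"
      using c by (metis mult_left_cancel)
    thus ?thesis using M by simp
  qed
  hence "hamiltonian_system hamiltonian I lam mu"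
    unfolding hamiltonian_system_heun_iff using y' p by auto
  thus ?thesis by (rule that)
qed

section \<open>Heun equations and Painleve VI\<close>

text \<open>
At a zero of \<open>\<sigma>\<close>, the value of \<open>\<tau>\<close> is \<open>\<gamma>\<close>, \<open>\<delta>\<close> or \<open>\<epsilon>\<close> times a product of differences of
distinct singular points. So there is no common root as long as these three are nonzero.
\<close>

lemma polynomial_form_heun:
  assumes "\<gamma> \<noteq> 0" "\<delta> \<noteq> 0" "\<epsilon> \<noteq> 0" "0 \<notin> I" "1 \<notin> I"
  shows "polynomial_form I
    (\<lambda>t x. \<gamma> / x + \<delta> / (x - 1) + \<epsilon> / (x - of_real t))
    (\<lambda>t x. (k * x + h t) / (x * (x - 1) * (x - of_real t)))
    sigma_poly tau_poly (\<lambda>t. [:h t, k:])"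
  unfolding polynomial_form_def
proof (intro ballI conjI allI impI)
  fix t x assume t: "t \<in> I"
  show "sigma_poly t \<noteq> 0" by (simp add: sigma_poly_def)
  have "t \<noteq> 0" "t \<noteq> 1" using t assms by auto
  thus "\<nexists>x. poly (sigma_poly t) x = 0 \<and> poly (tau_poly t) x = 0 \<and> poly [:h t, k:] x = 0"
    using assms(1-3)
    by (auto simp: poly_sigma poly_tau cubic_eq_0_iff drift_def cubic'_def algebra_simps)
  assume "poly (sigma_poly t) x \<noteq> 0"
  hence "x \<noteq> 0" "x - 1 \<noteq> 0" "x - t \<noteq> 0" by (auto simp: poly_sigma cubic_eq_0_iff)
  thus "\<gamma> / x + \<delta> / (x - 1) + \<epsilon> / (x - of_real t) = poly (tau_poly t) x / poly (sigma_poly t) x"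
    unfolding poly_sigma poly_tau cubic_def cubic'_def drift_def
    by (simp add: divide_simps) (simp add: algebra_simps)
  show "(k * x + h t) / (x * (x - 1) * (x - of_real t)) = poly [:h t, k:] x / poly (sigma_poly t) x"
    by (simp add: poly_sigma cubic_def mult.commute add.commute)
qed

end

theorem heun_isomonodromic_to_P6:
  assumes "\<gamma> \<noteq> 0" "\<delta> \<noteq> 0" "\<epsilon> \<noteq> 0" "0 \<notin> T" "1 \<notin> T"
  shows "isomonodromic_to_P6 T
    (\<lambda>t x. \<gamma> / x + \<delta> / (x - 1) + \<epsilon> / (x - of_real t))
    (\<lambda>t x. (k * x + h t) / (x * (x - 1) * (x - of_real t)))"
proof -
  interpret heun \<gamma> \<delta> \<epsilon> k .
  have sub: "0 \<notin> I" "1 \<notin> I" if "I \<subseteq> T" for I using that assms(4,5) by auto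
  show ?thesis
    unfolding isomonodromic_to_P6_def
  proof (intro exI conjI allI impI)
    show "polynomial_form T (\<lambda>t x. \<gamma> / x + \<delta> / (x - 1) + \<epsilon> / (x - of_real t))
      (\<lambda>t x. (k * x + h t) / (x * (x - 1) * (x - of_real t)))
      sigma_poly tau_poly (\<lambda>t. [:h t, k:])"
      using assms by (rule polynomial_form_heun)
  next
    fix I and lam mu :: "real \<Rightarrow> complex"
    assume "open I \<and> I \<subseteq> T \<and> (\<forall>t\<in>I. lam differentiable (at t) \<and> mu differentiable (at t)
                     \<and> poly (sigma_poly t) (lam t) \<noteq> 0)"
    thus "deformed_compatible sigma_poly tau_poly (\<lambda>t. [:h t, k:]) I lam mu
        (\<lambda>t. (\<lambda>t l m. compat_a t l) t (lam t) (mu t)) (\<lambda>t. (\<lambda>t l m. compat_b t l m) t (lam t) (mu t))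
      \<longleftrightarrow> hamiltonian_system hamiltonian I lam mu"
      using sub by (intro deformed_compatible_iff_hamiltonian_system) (auto simp: poly_sigma)
  next
    fix I and lam :: "real \<Rightarrow> complex"
    assume "open I \<and> I \<subseteq> T \<and> (\<forall>t\<in>I. poly (sigma_poly t) (lam t) \<noteq> 0)"
    hence I: "open I" "0 \<notin> I" "1 \<notin> I" "\<And>t. t \<in> I \<Longrightarrow> cubic t (lam t) \<noteq> 0"
      using sub by (auto simp: poly_sigma)
    show "(\<exists>mu. hamiltonian_system hamiltonian I lam mu) \<longleftrightarrow> solves_P6 P6_A P6_B P6_C P6_D I lam"
      using hamiltonian_system_imp_P6[OF I(2-4)] P6_imp_hamiltonian_system[OF I] by metis
  qed
qed

text \<open>
The equation is the case \<open>\<gamma> = - 1/2\<close>, \<open>\<delta> = 1 + \<alpha>\<close>, \<open>\<epsilon> = 1\<close> with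
\<open>k = - n (n + 2 \<alpha> + 1) / 4\<close> and \<open>h(t) = - n \<surd>t / 4\<close>.
\<close>

theorem theorem6p1:
  fixes n :: nat and \<alpha> :: real
  assumes "n \<ge> 1" and "\<alpha> > 0"
  shows "isomonodromic_to_P6 {0<..<1}
    (\<lambda>t x. - 1 / (2 * x) + (1 + of_real \<alpha>) / (x - 1) + 1 / (x - of_real t))
    (\<lambda>t x. - (of_nat n * (of_nat n + 2 * of_real \<alpha> + 1) * x + of_nat n * of_real (sqrt t))
           / (4 * x * (x - 1) * (x - of_real t)))"
proof -
  define k :: complex where "k = - of_nat n * (of_nat n + 2 * of_real \<alpha> + 1) / 4"
  define h :: "real \<Rightarrow> complex" where "h t = - of_nat n * of_real (sqrt t) / 4" for t
  have "complex_of_real (1 + \<alpha>) \<noteq> 0" using assms(2) unfolding of_real_eq_0_iff by simp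
  hence "isomonodromic_to_P6 {0<..<1}
    (\<lambda>t x. (- 1 / 2) / x + (1 + of_real \<alpha>) / (x - 1) + 1 / (x - of_real t))
    (\<lambda>t x. (k * x + h t) / (x * (x - 1) * (x - of_real t)))"
    by (intro heun_isomonodromic_to_P6) auto
  moreover have "(- 1 / 2) / x = - 1 / (2 * x)" for x :: complex by simp
  moreover have "(k * x + h t) / (x * (x - 1) * (x - of_real t))
     = - (of_nat n * (of_nat n + 2 * of_real \<alpha> + 1) * x + of_nat n * of_real (sqrt t))
           / (4 * x * (x - 1) * (x - of_real t))" for t x
  proof -
    have *: "k * x + h t
      = - (of_nat n * (of_nat n + 2 * of_real \<alpha> + 1) * x + of_nat n * of_real (sqrt t)) / 4"
      by (simp add: k_def h_def field_simps)
    show ?thesis unfolding * divide_divide_eq_left by (simp only: mult.assoc)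
  qed
  ultimately show ?thesis by simp
qed

end
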